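(* There exists an absolute constant $c>0$ such that the following holds for every prime $p$. Let $\mathcal{I}=\{n+1,n+2,\ldots,n+N\}\pmod p\subset\mathbb{F}_p$ be an interval with $|\mathcal{I}|<cp$, and suppose $\mathcal{I}$ has a nontrivial multiplicative decomposition. Then either $$\mathcal{I}=\pm\{3^*-1,\,3^*,\,3^*+1\}\pmod p,$$ or $$\mathcal{I}=-\mathcal{I}.$$ Moreover, in the latter case, for any sets $\mathcal{A},\mathcal{B}\subset\mathbb{F}_p$ with $|\mathcal{A}|\ge2$, $|\mathcal{B}|\ge2$ and $\mathcal{I}\setminus\{0\}=\mathcal{A}\mathcal{B}$, one of the sets $\mathcal{A}$ or $\mathcal{B}$ coincides with $\{-r,r\}$ for some residue class $r\in\mathbb{F}_p$.
   Context: $\mathbb{F}_p$ is the field of residues modulo the prime $p$. For $\mathcal{A},\mathcal{B}\subset\mathbb{F}_p$, $\mathcal{A}\mathcal{B}=\{ab:\ a\in\mathcal{A},\ b\in\mathcal{B}\}$, and $-\mathcal{S}=\{-s: s\in\mathcal{S}\}$. An interval in $\mathbb{F}_p$ is a set of the form $\{n+1,n+2,\ldots,n+N\}\pmod p$ with integers $n$ and $N\ge 1$. A set $\mathcal{S}\subset\mathbb{F}_p$ is said to have a nontrivial multiplicative decomposition if $\mathcal{S}\setminus\{0\}=\mathcal{A}\mathcal{B}$ for some sets $\mathcal{A},\mathcal{B}\subset\mathbb{F}_p$ with $|\mathcal{A}|\ge2$ and $|\mathcal{B}|\ge2$. For an integer $m$ not divisible by $p$, $m^*$ denotes the multiplicative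 inverse of $m$ modulo $p$. *)

theory Defs
  imports Complex_Main "HOL-Number_Theory.Residues"
begin

text \<open>
  The field of residues modulo a prime \<open>p\<close> is \<^term>\<open>residue_ring (int p)\<close>, whose elements are the
  canonical representatives \<open>0, \<dots>, p - 1\<close>. Products of sets are formed with the library's
  \<^const>\<open>set_mult\<close>.
\<close>

abbreviation Fp :: "nat \<Rightarrow> int ring" where
  "Fp p \<equiv> residue_ring (int p)"

definition neg_set :: "nat \<Rightarrow> int set \<Rightarrow> int set" where
  "neg_set p S = {\<ominus>\<^bsub>Fp p\<^esub> s | s. s \<in> S}"

definition interval_mod :: "nat \<Rightarrow> int \<Rightarrow> nat \<Rightarrow> int set" where
  "interval_mod p n N = {(n + int i) mod int p | i. 1 \<le> i \<and> i \<le> N}"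

definition nontrivial_mult_decomp_by :: "nat \<Rightarrow> int set \<Rightarrow> int set \<Rightarrow> int set \<Rightarrow> bool" where
  "nontrivial_mult_decomp_by p S A B \<longleftrightarrow>
     A \<subseteq> carrier (Fp p) \<and> B \<subseteq> carrier (Fp p) \<and> card A \<ge> 2 \<and> card B \<ge> 2 \<and>
     S - {\<zero>\<^bsub>Fp p\<^esub>} = A <#>\<^bsub>Fp p\<^esub> B"

definition has_nontrivial_mult_decomp :: "nat \<Rightarrow> int set \<Rightarrow> bool" where
  "has_nontrivial_mult_decomp p S \<longleftrightarrow> (\<exists>A B. nontrivial_mult_decomp_by p S A B)"

text \<open>The inverse of the class of \<open>m\<close>; meaningful only when \<open>p\<close> does not divide \<open>m\<close>.\<close>

definition inv_mod :: "nat \<Rightarrow> int \<Rightarrow> int" where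
  "inv_mod p m = inv\<^bsub>Fp p\<^esub> (m mod int p)"

definition exceptional_set :: "nat \<Rightarrow> int set" where
  "exceptional_set p =
     {inv_mod p 3 \<ominus>\<^bsub>Fp p\<^esub> \<one>\<^bsub>Fp p\<^esub>, inv_mod p 3, inv_mod p 3 \<oplus>\<^bsub>Fp p\<^esub> \<one>\<^bsub>Fp p\<^esub>}"

end

theory Submission
  imports Defs
begin

text \<open>
  Let \<open>I - {0} = AB\<close> with \<open>|I| = N < cp\<close>. All products \<open>(a - a')b\<close> lie in \<open>[-N, N]\<close>, so
  \<open>k(A - A)\<close> times \<open>B\<close> stays in \<open>[-kN, kN]\<close>, and orthogonality of characters gives
  \<open>|k(A - A)| |B| \<le> 2p\<close> whenever \<open>8kN \<le> p\<close>. As \<open>|A| |B| \<ge> N - 1\<close>, the sumset \<open>k(A - A)\<close> has only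
  \<open>O(k|A|)\<close> elements for \<open>k\<close> of order \<open>p / N\<close>. Multiplication by an element of \<open>B\<close> moves \<open>A - A\<close> into
  the integers \<open>[-N, N]\<close> without wrap-around, and there such slow growth forces a bounded sumset of
  \<open>A - A\<close> to fill a progression \<open>u[-l, l]\<close> containing \<open>A - A\<close>, with \<open>l\<close> at least of order \<open>|A|\<close>;
  likewise \<open>v[-l', l']\<close> for \<open>B\<close>.

  Then \<open>vA\<close>, \<open>uB\<close> and \<open>g = uv\<close> are represented by integers so small that \<open>(vA)(uB) = gI - {0}\<close> is an
  identity of sets of integers, where \<open>gI\<close> is a progression with difference \<open>g\<close> and the elements of each
  factor are congruent modulo \<open>g\<close>. Comparing the element of largest absolute value of that progression
  with its neighbour leaves only a factor \<open>{-r, r}\<close> or the progression \<open>\<plusminus>{-2, 1, 4}\<close>.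
\<close>

section \<open>Products of integer sets forming a progression\<close>

lemma eq_pair_if_card_ge_2:
  assumes "card S \<ge> 2" "S \<subseteq> {c, d}"
  shows "S = {c, d}"
  using card_seteq[of "{c, d}" S] assms by (simp add: card_insert_if split: if_splits)

text \<open>As \<open>a\<close> and \<open>b\<close> have maximal absolute value,
  \<open>a * b\<close> is the last term of the progression. The term before it,
  \<open>a * b - g\<close>, must be a product too, and since elements of a factor differ by
  multiples of \<open>g\<close>, both of its factors are negative. Unless a factor is
  \<open>{- r, r}\<close>, an exact identity then leaves \<open>a = b = 2\<close>,
  \<open>g = 3\<close> and the progression \<open>-2, 1, 4\<close>.\<close>

lemma integer_ap_product_of_max:
  fixes A B :: "int set" and g n :: int and N :: nat
  assumes g: "g > 0"
    and dA: "\<And>x y. x \<in> A \<Longrightarrow> y \<in> A \<Longrightarrow> g dvd x - y"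
    and dB: "\<And>x y. x \<in> B \<Longrightarrow> y \<in> B \<Longrightarrow> g dvd x - y"
    and cA: "card A \<ge> 2" and cB: "card B \<ge> 2"
    and AB: "{x * y |x y. x \<in> A \<and> y \<in> B} = {n + g * int i |i. 1 \<le> i \<and> i \<le> N} - {0}"
    and a: "a \<in> A" "\<And>x. x \<in> A \<Longrightarrow> \<bar>x\<bar> \<le> a"
    and b: "b \<in> B" "\<And>y. y \<in> B \<Longrightarrow> \<bar>y\<bar> \<le> b"
  shows "(\<exists>r. A = {- r, r}) \<or> (\<exists>r. B = {- r, r}) \<or> (N = 3 \<and> 3 * (n + 2 * g) = g)"
proof (rule ccontr)
  assume neg: "\<not> ?thesis"
  have mem: "x * y \<in> {n + g * int i |i. 1 \<le> i \<and> i \<le> N}" "x * y \<noteq> 0" if "x \<in> A" "y \<in> B" for x y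
    using AB that by blast+
  have nz: "x \<noteq> 0" if "x \<in> A" for x using mem(2)[OF that b(1)] by auto
  have nzB: "y \<noteq> 0" if "y \<in> B" for y using mem(2)[OF a(1) that] by auto
  have notsub: "\<not> A \<subseteq> {- c, c}" "\<not> B \<subseteq> {- c, c}" for c
    using eq_pair_if_card_ge_2[OF cA] eq_pair_if_card_ge_2[OF cB] neg by blast+
  have a2: "a \<ge> 2"
  proof (rule ccontr)
    assume "\<not> a \<ge> 2"
    then have "A \<subseteq> {- 1, 1}" using a(2) nz by force
    then show False using notsub by blast
  qed
  have b2: "b \<ge> 2"
  proof (rule ccontr)
    assume "\<not> b \<ge> 2"
    then have "B \<subseteq> {- 1, 1}" using b(2) nzB by force
    then show False using notsub by blast
  qed
  have step: "x = a \<or> x \<le> a - g" if "x \<in> A" for x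
    using dA[OF a(1) that] a(2)[OF that] g by (smt (verit) zdvd_not_zless)
  have stepB: "y = b \<or> y \<le> b - g" if "y \<in> B" for y
    using dB[OF b(1) that] b(2)[OF that] g by (smt (verit) zdvd_not_zless)
  \<comment> \<open>Every \<open>x\<close> in \<open>A\<close> other than \<open>a\<close> satisfies
    \<open>x \<le> a - g \<le> - a\<close>, hence equals \<open>- a\<close>.\<close>
  have small: "A \<subseteq> {- a, a}" if "2 * a \<le> g"
    using step a(2) that by force
  have ga: "g < 2 * a" using small notsub by force
  have "\<not> B \<subseteq> {-b,b}" using notsub by blast
  then have gb: "g < 2 * b" using stepB b(2) by force
  \<comment> \<open>This makes \<open>a * b\<close> and \<open>a * b - g\<close> positive, so
    neither is the removed value 0.\<close>
  have abg: "a * b > g"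
  proof -
    have "2 * a \<le> a * b" using a2 b2 by (simp add: mult.commute mult_right_mono)
    then show ?thesis using ga by linarith
  qed
  have le: "x * y \<le> a * b" if "x \<in> A" "y \<in> B" for x y
  proof -
    have "\<bar>x * y\<bar> \<le> a * b" unfolding abs_mult using a(2)[OF that(1)] b(2)[OF that(2)]
      by (intro mult_mono) auto
    then show ?thesis by linarith
  qed
  obtain i where i: "a * b = n + g * int i" "1 \<le> i" "i \<le> N" using mem(1)[OF a(1) b(1)] by blast
  have top: "a * b = n + g * int N"
  proof -
    have gN: "g * int i \<le> g * int N" using g i by simp
    have "n + g * int N \<noteq> 0" using gN i(1) abg g by linarith
    then have "n + g * int N \<in> {x * y |x y. x \<in> A \<and> y \<in> B}"
      unfolding AB using i by force
    then have "n + g * int N \<le> a * b" using le by force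
    then show ?thesis using gN i(1) by linarith
  qed
  have inAB: "\<exists>x\<in>A. \<exists>y\<in>B. a * b - g * int j = x * y" if "j < N" "a * b - g * int j \<noteq> 0" for j
  proof -
    have e: "a * b - g * int j = n + g * int (N - j)"
      using that(1) top by (simp add: of_nat_diff right_diff_distrib)
    have "a * b - g * int j \<in> {n + g * int i |i. 1 \<le> i \<and> i \<le> N} - {0}"
      using that unfolding e by (auto intro!: exI[of _ "N - j"])
    then show ?thesis unfolding AB[symmetric] by blast
  qed
  obtain x0 where x0: "x0 \<in> A" "x0 \<noteq> a" using notsub(1)[of a] by blast
  have "x0 * b \<noteq> a * b" using x0 b2 by simp
  then have N2: "N \<ge> 2"
  proof -
    obtain j where j: "x0 * b = n + g * int j" "1 \<le> j" "j \<le> N" using mem(1)[OF x0(1) b(1)] by blast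
    have "i \<noteq> j" using \<open>x0 * b \<noteq> a * b\<close> i j by auto
    then show ?thesis using i j by linarith
  qed
  txt \<open>The second largest term \<open>a * b - g\<close> is too close to \<open>a * b\<close> to be a product of positive elements.\<close>
  obtain x y where xy: "x \<in> A" "y \<in> B" "a * b - g = x * y"
    using inAB[of 1] N2 abg by auto
  have sgn: "x < 0" "y < 0"
  proof -
    have pos: "x * y > 0" using xy abg by linarith
    \<comment> \<open>Lowering one positive factor by at least \<open>g\<close> lowers the product
      by at least \<open>g\<close> times the other maximum, hence by at least
      \<open>2 * g\<close>.\<close>
    have "\<not> (x > 0 \<and> y > 0)"
    proof
      assume p: "x > 0 \<and> y > 0"
      show False
      proof (cases "x = a")
        case True
        then have "y \<le> b - g" using stepB[OF xy(2)] xy(3) g by auto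
        then have "x * y \<le> a * (b - g)" using True p by (simp add: mult_left_mono)
        then have "a * g \<le> g" using xy(3) by (simp add: right_diff_distrib)
        then show False using mult_right_mono[OF a2, of g] g by linarith
      next
        case False
        then have "x \<le> a - g" using step[OF xy(1)] by auto
        moreover have "y \<le> b" using b(2)[OF xy(2)] by linarith
        ultimately have "x * y \<le> (a - g) * b" using p by (intro mult_mono) auto
        then have "g * b \<le> g" using xy(3) by (simp add: left_diff_distrib)
        then show False using mult_left_mono[OF b2, of g] g by linarith
      qed
    qed
    then show "x < 0" "y < 0" using pos by (auto simp: zero_less_mult_iff)
  qed
  \<comment> \<open>These defects satisfy
    \<open>d * (b - y) + e * (a - x) = 2 * (a * b - x * y) = 2 * g\<close>. Dividing by
    \<open>g\<close> leaves \<open>d * m' + e * m = 2\<close> in nonnegative integers.\<close>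
  define d where "d = a + x"
  define e where "e = b + y"
  have d0: "d \<ge> 0" and e0: "e \<ge> 0" unfolding d_def e_def using a(2)[OF xy(1)] b(2)[OF xy(2)] by linarith+
  obtain m where m: "a - x = g * m" using dA[OF a(1) xy(1)] by (auto elim: dvdE)
  obtain m' where m': "b - y = g * m'" using dB[OF b(1) xy(2)] by (auto elim: dvdE)
  have mpos: "m \<ge> 1" "m' \<ge> 1"
    using m m' sgn a2 b2 g by (smt (verit) zero_less_mult_iff)+
  have "g * (d * m' + e * m) = d * (b - y) + e * (a - x)" unfolding m m' by (simp add: algebra_simps)
  also have "\<dots> = 2 * (a * b - x * y)" unfolding d_def e_def by (simp add: algebra_simps)
  also have "\<dots> = g * 2" using xy(3) by simp
  finally have sum2: "d * m' + e * m = 2" using g by simp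
  \<comment> \<open>If \<open>x = - a\<close>, then \<open>2 * a = g * m\<close>. Here
    \<open>m = 1\<close> contradicts \<open>g < 2 * a\<close>, and \<open>m = 2\<close> gives
    \<open>a = g\<close>, so all elements of \<open>A\<close> are nonzero multiples of
    \<open>g\<close> of absolute value at most \<open>g\<close>.\<close>
  have A_case: "d \<noteq> 0"
  proof
    assume that: "d = 0"
    have "e * m = 2" using sum2 that by simp
    then have "m dvd 2" by (metis dvd_triv_right)
    then have "m \<le> 2" by (simp add: zdvd_imp_le)
    have xa: "x = - a" using that d_def by simp
    show False
    proof (cases "m = 1")
      case True
      then show False using m xa ga by simp
    next
      case False
      then have "m = 2" using \<open>m \<le> 2\<close> mpos by linarith
      then have ag: "a = g" using m xa by simp
      have "A \<subseteq> {- a, a}"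
      proof
        fix z assume z: "z \<in> A"
        have "g dvd z" using dA[OF z a(1)] ag by (simp add: dvd_diff_left_iff)
        then show "z \<in> {- a, a}" using a(2)[OF z] nz[OF z] ag
          dvd_imp_le_int[of z g] by (simp add: abs_if split: if_splits)
      qed
      then show False using notsub by blast
    qed
  qed
  have B_case: "e \<noteq> 0"
  proof
    assume that: "e = 0"
    have "d * m' = 2" using sum2 that by simp
    then have "m' dvd 2" by (metis dvd_triv_right)
    then have "m' \<le> 2" by (simp add: zdvd_imp_le)
    have xa: "y = - b" using that e_def by simp
    show False
    proof (cases "m' = 1")
      case True
      then show False using m' xa gb by simp
    next
      case False
      then have "m' = 2" using \<open>m' \<le> 2\<close> mpos by linarith
      then have ag: "b = g" using m' xa by simp
      have "B \<subseteq> {- b, b}"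
      proof
        fix z assume z: "z \<in> B"
        have "g dvd z" using dB[OF z b(1)] ag by (simp add: dvd_diff_left_iff)
        then show "z \<in> {- b, b}" using b(2)[OF z] nzB[OF z] ag
          dvd_imp_le_int[of z g] by (simp add: abs_if split: if_splits)
      qed
      then show False using notsub by blast
    qed
  qed
  have "d \<ge> 1" "e \<ge> 1" using A_case B_case d0 e0 by linarith+
  have "d * m' \<ge> d" "d * m' \<ge> m'" "e * m \<ge> e" "e * m \<ge> m"
    using \<open>d \<ge> 1\<close> \<open>e \<ge> 1\<close> mpos by (simp_all add: mult_le_cancel_left1 mult_le_cancel_right1)
  then have one: "d = 1" "e = 1" "m = 1" "m' = 1" using sum2 \<open>d \<ge> 1\<close> \<open>e \<ge> 1\<close> mpos by linarith+
  have x: "x = 1 - a" and y: "y = 1 - b" and ga2: "g = 2 * a - 1" and gb2: "g = 2 * b - 1"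
    using one d_def e_def m m' by auto
  have ba: "b = a" using ga2 gb2 by simp
  have Aeq: "z = a \<or> z = 1 - a" if "z \<in> A" for z
  proof -
    obtain k where k: "a - z = g * k" using dA[OF a(1) \<open>z \<in> A\<close>] by (auto elim: dvdE)
    have "g * k \<ge> 0" "g * k < g * 2" using k a(2)[OF that] ga2 a2 by auto
    then have "k \<ge> 0" "k < 2" using g by (auto simp: zero_le_mult_iff)
    then have "k = 0 \<or> k = 1" by linarith
    then show ?thesis using k ga2 by auto
  qed
  have Beq: "z = a \<or> z = 1 - a" if "z \<in> B" for z
  proof -
    obtain k where k: "b - z = g * k" using dB[OF b(1) \<open>z \<in> B\<close>] by (auto elim: dvdE)
    have "g * k \<ge> 0" "g * k < g * 2" using k b(2)[OF that] gb2 b2 by auto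
    then have "k \<ge> 0" "k < 2" using g by (auto simp: zero_le_mult_iff)
    then have "k = 0 \<or> k = 1" by linarith
    then show ?thesis using k ga2 ba by auto
  qed
  \<comment> \<open>The product \<open>x * b\<close> is negative, so it lies below the positive term
    \<open>a * b - g\<close>.\<close>
  have N3: "N \<ge> 3"
  proof -
    obtain j where j: "x * b = n + g * int j" "1 \<le> j" "j \<le> N" using mem(1)[OF xy(1) b(1)] by blast
    have "x * b < 0" using sgn b2 by (simp add: mult_less_0_iff)
    then have "g * int j < g * int (N - 1)" using j(1) top abg N2
      by (simp add: of_nat_diff right_diff_distrib)
    then have "j < N - 1" using g by simp
    then show ?thesis using j by linarith
  qed
  have prods: "w \<in> {a * a, (1 - a) * (1 - a), a * (1 - a)}" if "u \<in> A" "v \<in> B" "w = u * v" for u v w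
    using Aeq[OF that(1)] Beq[OF that(2)] that(3) by auto
  \<comment> \<open>The third term from the top is \<open>a * a - 2 * g = (a - 2)^2 - 2\<close>,
    never 0, hence a product. Of the three possible products only \<open>a * (1 - a)\<close> can
    equal it, and only for \<open>a = 2\<close>.\<close>
  have a2': "a = 2"
  proof -
    have "a * a - g * 2 \<noteq> 0"
    proof
      assume "a * a - g * 2 = 0"
      then have "(a - 2) * (a - 2) = 2" using ga2 by (simp add: algebra_simps)
      then have "(a - 2)^2 = 2" by (simp add: power2_eq_square)
      moreover have "(k::int)^2 \<noteq> 2" for k
      proof
        assume k: "k^2 = 2"
        have "\<bar>k\<bar> < 2" using power2_less_imp_less[of "\<bar>k\<bar>" 2] k by simp
        then have "k = 0 \<or> k = 1 \<or> k = -1" by linarith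
        then show False using k by auto
      qed
      ultimately show False by blast
    qed
    then obtain u v where "u \<in> A" "v \<in> B" "a * a - g * 2 = u * v"
      using inAB[of 2] N3 ba by auto
    then have "a * a - g * 2 \<in> {a * a, (1 - a) * (1 - a), a * (1 - a)}" using prods by blast
    then have "a * a - g * 2 = a * (1 - a)"
      using ga2 a2 by (auto simp: algebra_simps)
    then have "(2 * a - 1) * (a - 2) = 0" using ga2 by (simp add: algebra_simps)
    then show ?thesis using a2 by auto
  qed
  have "N = 3"
  proof (rule ccontr)
    assume "N \<noteq> 3"
    then obtain u v where "u \<in> A" "v \<in> B" "a * b - g * 3 = u * v"
      using inAB[of 3] N3 ba a2' ga2 by auto
    then show False using prods[of u v "a * b - g * 3"] ba a2' ga2 by auto
  qed
  then show False using neg top ba a2' ga2 by auto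
qed

text \<open>Multiplying each factor by a sign makes its element of largest absolute value positive;
  the absolute value in the last alternative absorbs these signs.\<close>

lemma integer_ap_product:
  fixes A B :: "int set" and g n :: int and N :: nat
  assumes g: "g > 0"
    and dA: "\<And>x y. x \<in> A \<Longrightarrow> y \<in> A \<Longrightarrow> g dvd x - y"
    and dB: "\<And>x y. x \<in> B \<Longrightarrow> y \<in> B \<Longrightarrow> g dvd x - y"
    and cA: "card A \<ge> 2" and cB: "card B \<ge> 2"
    and AB: "{x * y |x y. x \<in> A \<and> y \<in> B} = {n + g * int i |i. 1 \<le> i \<and> i \<le> N} - {0}"
  shows "(\<exists>r. A = {- r, r}) \<or> (\<exists>r. B = {- r, r}) \<or> (N = 3 \<and> \<bar>3 * (n + 2 * g)\<bar> = g)"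
proof -
  define sg :: "int \<Rightarrow> int set \<Rightarrow> int set" where "sg e S = (\<lambda>x. e * x) ` S" for e S
  have pick: "\<exists>e a. (e = 1 \<or> e = -1) \<and> a \<in> sg e S \<and> (\<forall>x\<in>sg e S. \<bar>x\<bar> \<le> a)" if "card S \<ge> 2" for S
  proof -
    have "finite S" "S \<noteq> {}" using that by (auto intro: card_ge_0_finite)
    then have "Max (abs ` S) \<in> abs ` S" by (intro Max_in) auto
    then obtain a where a: "a \<in> S" "\<bar>a\<bar> = Max (abs ` S)" by auto
    then have le: "\<bar>x\<bar> \<le> \<bar>a\<bar>" if "x \<in> S" for x using that \<open>finite S\<close> by simp
    show ?thesis
    proof (cases "a \<ge> 0")
      case True
      then show ?thesis using a le unfolding sg_def by (intro exI[of _ 1] exI[of _ a]) auto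
    next
      case False
      then show ?thesis using a le unfolding sg_def by (intro exI[of _ "-1"] exI[of _ "-a"]) force
    qed
  qed
  obtain e a where e: "e = 1 \<or> e = -1" and a: "a \<in> sg e A" "\<And>x. x \<in> sg e A \<Longrightarrow> \<bar>x\<bar> \<le> a"
    using pick[OF cA] by blast
  obtain f b where f: "f = 1 \<or> f = -1" and b: "b \<in> sg f B" "\<And>x. x \<in> sg f B \<Longrightarrow> \<bar>x\<bar> \<le> b"
    using pick[OF cB] by blast
  have csg: "card (sg e S) = card S" if "e = 1 \<or> e = -1" for e S
    unfolding sg_def using that by (intro card_image) (auto simp: inj_on_def)
  have dsg: "g dvd x - y" if "\<And>x y. x \<in> S \<Longrightarrow> y \<in> S \<Longrightarrow> g dvd x - y" "x \<in> sg e S" "y \<in> sg e S" for S e x y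
    using that unfolding sg_def by (auto simp: right_diff_distrib[symmetric])
  \<comment> \<open>For \<open>e * f = -1\<close> the progression is reflected: index
    \<open>i\<close> goes to \<open>N + 1 - i\<close>, which determines the new starting
    value.\<close>
  define n' where "n' = (if e * f = 1 then n else - n - g * (int N + 1))"
  have P: "{x * y |x y. x \<in> sg e A \<and> y \<in> sg f B} = sg (e * f) {x * y |x y. x \<in> A \<and> y \<in> B}"
    unfolding sg_def by (auto simp: image_iff) (metis mult.assoc mult.left_commute)+
  have Q: "sg (e * f) ({n + g * int i |i. 1 \<le> i \<and> i \<le> N} - {0}) = {n' + g * int i |i. 1 \<le> i \<and> i \<le> N} - {0}"
  proof (cases "e * f = 1")
    case True
    then show ?thesis unfolding n'_def sg_def by simp
  next
    case False
    then have ef: "e * f = -1" using e f by auto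
    have 1: "\<exists>j. - (n + g * int i) = n' + g * int j \<and> 1 \<le> j \<and> j \<le> N" if "1 \<le> i" "i \<le> N" for i
      using that False unfolding n'_def
      by (intro exI[of _ "N + 1 - i"]) (auto simp: of_nat_diff algebra_simps)
    have 2: "\<exists>j. n' + g * int i = - (n + g * int j) \<and> 1 \<le> j \<and> j \<le> N" if "1 \<le> i" "i \<le> N" for i
      using that False unfolding n'_def
      by (intro exI[of _ "N + 1 - i"]) (auto simp: of_nat_diff algebra_simps)
    show ?thesis
    proof (intro Set.set_eqI iffI)
      fix z assume "z \<in> sg (e * f) ({n + g * int i |i. 1 \<le> i \<and> i \<le> N} - {0})"
      then obtain w where w: "w \<in> {n + g * int i |i. 1 \<le> i \<and> i \<le> N} - {0}" "z = - w"
        unfolding sg_def ef by auto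
      then obtain i where "w = n + g * int i" "1 \<le> i" "i \<le> N" by blast
      moreover have "z \<noteq> 0" using w by simp
      ultimately have "z = - (n + g * int i)" "z \<noteq> 0" "1 \<le> i" "i \<le> N" using w by auto
      then show "z \<in> {n' + g * int i |i. 1 \<le> i \<and> i \<le> N} - {0}" using 1[of i] by auto
    next
      fix z assume "z \<in> {n' + g * int i |i. 1 \<le> i \<and> i \<le> N} - {0}"
      then obtain i where i: "z = n' + g * int i" "z \<noteq> 0" "1 \<le> i" "i \<le> N" by auto
      then obtain j where "z = - (n + g * int j)" "1 \<le> j" "j \<le> N" using 2[of i] by auto
      then have "- z \<in> {n + g * int i |i. 1 \<le> i \<and> i \<le> N} - {0}" using i(2) by auto
      then show "z \<in> sg (e * f) ({n + g * int i |i. 1 \<le> i \<and> i \<le> N} - {0})"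
        unfolding sg_def ef by (auto intro!: image_eqI[of z _ "-z"])
    qed
  qed
  have "(\<exists>r. sg e A = {- r, r}) \<or> (\<exists>r. sg f B = {- r, r}) \<or> (N = 3 \<and> 3 * (n' + 2 * g) = g)"
  proof (rule integer_ap_product_of_max[OF g _ _ _ _ _ a b])
    show "g dvd x - y" if "x \<in> sg e A" "y \<in> sg e A" for x y using dsg[OF dA that] .
    show "g dvd x - y" if "x \<in> sg f B" "y \<in> sg f B" for x y using dsg[OF dB that] .
  qed (use csg[OF e] csg[OF f] cA cB P Q AB in auto)
  moreover have "\<exists>r. S = {- r, r}" if "sg e S = {- r, r}" "e = 1 \<or> e = -1" for S r e
  proof -
    have "S = sg e (sg e S)" unfolding sg_def image_image using that(2) by auto
    then show ?thesis unfolding that(1) using that(2) unfolding sg_def by auto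
  qed
  moreover have "\<bar>3 * (n + 2 * g)\<bar> = g" if "N = 3" "3 * (n' + 2 * g) = g"
    using that g unfolding n'_def by (auto split: if_splits simp: algebra_simps)
  ultimately show ?thesis using e f by blast
qed

section \<open>Sumsets and small residues\<close>

definition small_mod :: "int \<Rightarrow> int \<Rightarrow> int \<Rightarrow> bool" where
  "small_mod p M x \<longleftrightarrow> (\<exists>y. \<bar>y\<bar> \<le> M \<and> [x = y] (mod p))"

text \<open>For symmetric \<open>D\<close> containing 0 this is the ball of radius \<open>n\<close>
  about 0 in the word metric of \<open>D\<close>.\<close>

fun sumball :: "int set \<Rightarrow> nat \<Rightarrow> int set" where
  "sumball D 0 = {0}"
| "sumball D (Suc n) = (\<lambda>(x, d). x + d) ` (sumball D n \<times> D)"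

lemma sumball_SucI: "x \<in> sumball D n \<Longrightarrow> d \<in> D \<Longrightarrow> x + d \<in> sumball D (Suc n)"
  by force

lemma finite_sumball: "finite D \<Longrightarrow> finite (sumball D n)"
  by (induction n) auto

lemma sumball_add:
  "x \<in> sumball D m \<Longrightarrow> y \<in> sumball D n \<Longrightarrow> x + y \<in> sumball D (m + n)"
proof (induction n arbitrary: y)
  case (Suc n)
  then obtain z d where z: "z \<in> sumball D n" "d \<in> D" "y = z + d" by auto
  then have "(x + z) + d \<in> sumball D (Suc (m + n))" using Suc by (intro sumball_SucI) auto
  then show ?case using z by (simp add: add.assoc)
qed simp

lemma sumball_mono:
  assumes "0 \<in> D" "m \<le> n" shows "sumball D m \<subseteq> sumball D n"
  using assms(2)
proof (induction rule: dec_induct)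
  case (step k)
  have "sumball D k \<subseteq> sumball D (Suc k)" using sumball_SucI[of _ D k 0] assms(1) by auto
  then show ?case using step by blast
qed simp

lemma sumball_uminus:
  assumes "\<And>d. d \<in> D \<Longrightarrow> - d \<in> D"
  shows "x \<in> sumball D n \<Longrightarrow> - x \<in> sumball D n"
proof (induction n arbitrary: x)
  case (Suc n)
  then obtain z d where z: "z \<in> sumball D n" "d \<in> D" "x = z + d" by auto
  then have "- z + - d \<in> sumball D (Suc n)" using Suc assms by (intro sumball_SucI) auto
  then show ?case using z by simp
qed simp

lemma sumball_mult:
  "d \<in> D \<Longrightarrow> int n * d \<in> sumball D n"
proof (induction n)
  case (Suc n)
  then have "int n * d + d \<in> sumball D (Suc n)" by (intro sumball_SucI) auto
  then show ?case by (simp add: algebra_simps)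
qed simp

lemma small_mod_sumball:
  assumes "\<And>d. d \<in> D \<Longrightarrow> small_mod p M (z * d)"
  shows "x \<in> sumball D n \<Longrightarrow> small_mod p (int n * M) (z * x)"
proof (induction n arbitrary: x)
  case 0
  then show ?case by (auto simp: small_mod_def intro!: exI[of _ 0])
next
  case (Suc n)
  then obtain w d where w: "w \<in> sumball D n" "d \<in> D" "x = w + d" by auto
  obtain u where u: "\<bar>u\<bar> \<le> int n * M" "[z * w = u] (mod p)" using Suc w unfolding small_mod_def by blast
  obtain v where v: "\<bar>v\<bar> \<le> M" "[z * d = v] (mod p)" using assms w unfolding small_mod_def by blast
  have "[z * x = u + v] (mod p)" using cong_add[OF u(2) v(2)] w by (simp add: algebra_simps)
  moreover have "\<bar>u + v\<bar> \<le> int (Suc n) * M" using u v by (simp add: algebra_simps)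
  ultimately show ?case unfolding small_mod_def by blast
qed

lemma abs_sumball_le:
  assumes "\<And>d. d \<in> D \<Longrightarrow> \<bar>d\<bar> \<le> M"
  shows "x \<in> sumball D n \<Longrightarrow> \<bar>x\<bar> \<le> int n * M"
proof (induction n arbitrary: x)
  case (Suc n)
  then obtain z d where z: "z \<in> sumball D n" "d \<in> D" "x = z + d" by auto
  then show ?case using Suc.IH[of z] assms[of d] by (simp add: algebra_simps)
qed simp

lemma cong_small_imp_eq:
  fixes x y p :: int
  assumes "[x = y] (mod p)" "\<bar>x\<bar> \<le> M" "\<bar>y\<bar> \<le> M'" "M + M' < p"
  shows "x = y"
proof -
  have "p dvd x - y" using assms(1) by (simp add: cong_iff_dvd_diff)
  moreover have "\<bar>x - y\<bar> < p" using assms by linarith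
  ultimately show ?thesis by (metis abs_dvd_iff abs_ge_zero dvd_abs_iff eq_iff_diff_eq_0 zdvd_not_zless abs_0_eq less_le)
qed

text \<open>There is no wrap-around: if \<open>\<bar>y * i\<bar> \<le> M\<close>, then
  \<open>y * (i + 1)\<close> has absolute value at most \<open>2 * M\<close> and is congruent to a
  number of absolute value at most \<open>M\<close>. As \<open>3 * M < p\<close>, the two are equal,
  and induction reaches \<open>i = l\<close>.\<close>

lemma small_mod_multiples:
  assumes l: "l > 0" and M: "3 * M < p" and s: "\<And>i. \<bar>i\<bar> \<le> l \<Longrightarrow> small_mod p M (z * i)"
  shows "\<exists>y. [z = y] (mod p) \<and> \<bar>y\<bar> * l \<le> M"
proof -
  obtain y where y: "\<bar>y\<bar> \<le> M" "[z = y] (mod p)" using s[of 1] l by (auto simp: small_mod_def)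
  have "int i \<le> l \<longrightarrow> \<bar>y * int i\<bar> \<le> M" for i
  proof (induction i)
    case 0
    then show ?case using y by auto
  next
    case (Suc i)
    show ?case
    proof
      assume i: "int (Suc i) \<le> l"
      then obtain w where w: "\<bar>w\<bar> \<le> M" "[z * int (Suc i) = w] (mod p)"
        using s[of "int (Suc i)"] by (auto simp: small_mod_def)
      have "[y * int (Suc i) = w] (mod p)"
        using cong_trans[OF cong_scalar_right[OF cong_sym[OF y(2)]] w(2)] .
      moreover have "\<bar>y * int (Suc i)\<bar> \<le> 2 * M"
      proof -
        have "y * int (Suc i) = y * int i + y" by (simp add: algebra_simps)
        then show ?thesis using Suc y i by linarith
      qed
      ultimately have "y * int (Suc i) = w" using w M by (intro cong_small_imp_eq) auto
      then show "\<bar>y * int (Suc i)\<bar> \<le> M" using w by simp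
    qed
  qed
  from this[of "nat l"] have "\<bar>y\<bar> * l \<le> M" using l by (simp add: abs_mult)
  then show ?thesis using y by blast
qed

section \<open>Exponential sums: orthogonality, Parseval, and sets with small products\<close>

lemma sum_cis_multiples:
  fixes y :: int and p :: nat
  assumes "p > 0"
  shows "(\<Sum>t<p. cis (2 * pi * (real t * real_of_int y) / real p)) = (if int p dvd y then of_nat p else 0)"
proof -
  define w where "w = cis (2 * pi * real_of_int y / real p)"
  have pw: "cis (2 * pi * (real t * real_of_int y) / real p) = w ^ t" for t
    unfolding w_def DeMoivre by (simp add: field_simps)
  have wp: "w ^ p = 1"
    unfolding w_def DeMoivre using assms by simp
  show ?thesis
  proof (cases "w = 1")
    case True
    have "cos (2 * pi * real_of_int y / real p) = 1"
      using True unfolding w_def by (simp add: complex_eq_iff)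
    then obtain k :: int where "2 * pi * real_of_int y / real p = real_of_int k * (2 * pi)"
      by (auto simp: cos_one_2pi_int)
    then have "real_of_int y = real_of_int (k * int p)" using assms by (simp add: field_simps)
    then have "y = k * int p" by linarith
    then show ?thesis unfolding pw using True by simp
  next
    case False
    have "\<not> int p dvd y"
    proof
      assume "int p dvd y"
      then obtain k where "y = int p * k" by (auto elim: dvdE)
      then have "2 * pi * real_of_int y / real p = 2 * pi * real_of_int k" using assms by simp
      then have "w = 1" unfolding w_def by (simp only: cis_multiple_2pi Ints_of_int)
      then show False using False by simp
    qed
    then show ?thesis unfolding pw using False wp by (simp add: sum_gp_strict)
  qed
qed

text \<open>Parseval: after expanding the square, orthogonality keeps only the diagonal, because
  distinct elements of \<open>Y\<close> are incongruent modulo \<open>p\<close>.\<close>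

lemma sum_norm_square_expsum:
  fixes Y :: "int set" and p :: nat
  assumes p: "p > 0" and Y: "finite Y" "inj_on (\<lambda>y. y mod int p) Y"
  shows "(\<Sum>t<p. (cmod (\<Sum>y\<in>Y. cis (2 * pi * (real t * real_of_int y) / real p)))\<^sup>2) = real p * real (card Y)"
proof -
  define E where "E t y = cis (2 * pi * (real t * real_of_int y) / real p)" for t :: nat and y :: int
  have dist: "int p dvd (y - y') \<longleftrightarrow> y = y'" if "y \<in> Y" "y' \<in> Y" for y y'
    using Y(2) that by (metis inj_on_def mod_eq_dvd_iff dvd_0_right diff_self)
  have E: "E t y * cnj (E t y') = E t (y - y')" for t y y'
    unfolding E_def cis_cnj cis_mult by (simp add: algebra_simps diff_divide_distrib)
  have "complex_of_real (\<Sum>t<p. (cmod (\<Sum>y\<in>Y. E t y))\<^sup>2) = (\<Sum>t<p. (\<Sum>y\<in>Y. E t y) * cnj (\<Sum>y\<in>Y. E t y))"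
    by (simp only: of_real_sum complex_norm_square)
  also have "\<dots> = (\<Sum>t<p. \<Sum>y\<in>Y. \<Sum>y'\<in>Y. E t (y - y'))"
    by (simp add: sum_product E)
  also have "\<dots> = (\<Sum>y\<in>Y. \<Sum>y'\<in>Y. \<Sum>t<p. E t (y - y'))"
    by (subst sum.swap, intro sum.cong refl sum.swap)
  also have "\<dots> = (\<Sum>y\<in>Y. \<Sum>y'\<in>Y. if y = y' then of_nat p else 0)"
  proof (intro sum.cong refl)
    fix y y' assume "y \<in> Y" "y' \<in> Y"
    then show "(\<Sum>t<p. E t (y - y')) = (if y = y' then of_nat p else 0)"
      unfolding E_def using sum_cis_multiples[OF p, of "y - y'"] dist by simp
  qed
  also have "\<dots> = complex_of_real (real p * real (card Y))"
    using Y(1) by simp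
  finally show ?thesis unfolding E_def of_real_eq_iff .
qed

text \<open>Each phase \<open>x * y / p\<close> is within 1/8 of an integer, so at frequency
  \<open>x\<close> every term of the exponential sum over \<open>Y\<close> has real part at least
  \<open>sqrt 2 / 2\<close>. The elements of \<open>X\<close> are distinct frequencies with such
  large sums, and Parseval limits their number.\<close>

lemma card_mult_le_of_small_products:
  fixes X Y :: "int set" and p :: nat
  assumes p: "p > 0" and X: "finite X" "inj_on (\<lambda>y. y mod int p) X"
    and Y: "finite Y" "inj_on (\<lambda>y. y mod int p) Y" 
    and s: "\<And>x y. x \<in> X \<Longrightarrow> y \<in> Y \<Longrightarrow> small_mod (int p) M (x * y)" and M: "8 * M \<le> int p"
  shows "card X * card Y \<le> 2 * p"
proof (cases "card Y = 0")
  case False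
  define S where "S t = (\<Sum>y\<in>Y. cis (2 * pi * (real t * real_of_int y) / real p))" for t :: nat
  define f where "f x = nat (x mod int p)" for x
  have fX: "f ` X \<subseteq> {..<p}" unfolding f_def using p by (auto simp: nat_less_iff)
  have injf: "inj_on f X"
    using X(2) unfolding f_def inj_on_def using p by (metis nat_eq_iff2 pos_mod_sign of_nat_0_less_iff nat_0_le)
  have big: "(cmod (S (f x)))\<^sup>2 \<ge> (real (card Y))\<^sup>2 / 2" if x: "x \<in> X" for x
  proof -
    have cosb: "cos (2 * pi * (real (f x) * real_of_int y) / real p) \<ge> sqrt 2 / 2" if y: "y \<in> Y" for y
    proof -
      obtain w where w: "\<bar>w\<bar> \<le> M" "[x * y = w] (mod int p)" using s[OF x y] by (auto simp: small_mod_def)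
      have "[int (f x) * y = w] (mod int p)"
        unfolding f_def using w(2) p by (simp add: cong_def mod_mult_left_eq)
      then obtain k where k: "int (f x) * y = w + int p * k" by (metis cong_iff_lin cong_sym)
      have "real (f x) * real_of_int y = real_of_int (int (f x) * y)" by simp
      also have "\<dots> = real_of_int w + real p * real_of_int k" unfolding k by simp
      finally have "2 * pi * (real (f x) * real_of_int y) / real p = 2 * pi * real_of_int w / real p + 2 * pi * real_of_int k"
        using p by (simp add: field_simps)
      then have "cos (2 * pi * (real (f x) * real_of_int y) / real p) = cos (2 * pi * real_of_int w / real p)"
        by (simp add: cos_add)
      also have "\<dots> = cos (2 * pi * \<bar>real_of_int w\<bar> / real p)"
        by (cases "w \<ge> 0") auto
      also have "\<dots> \<ge> cos (pi / 4)"
      proof (rule cos_monotone_0_pi_le)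
        have "8 * \<bar>real_of_int w\<bar> \<le> real p" using w M by linarith
        then show "2 * pi * \<bar>real_of_int w\<bar> / real p \<le> pi / 4" using p by (simp add: field_simps)
      qed (use p in auto)
      finally show ?thesis by (simp add: cos_45)
    qed
    have "real (card Y) * (sqrt 2 / 2) \<le> (\<Sum>y\<in>Y. cos (2 * pi * (real (f x) * real_of_int y) / real p))"
      using sum_mono[OF cosb] by simp
    also have "\<dots> = Re (S (f x))" unfolding S_def by simp
    also have "\<dots> \<le> cmod (S (f x))" by (rule complex_Re_le_cmod)
    finally have "(real (card Y) * (sqrt 2 / 2))\<^sup>2 \<le> (cmod (S (f x)))\<^sup>2" by (intro power_mono) auto
    then show ?thesis by (simp add: power_mult_distrib power_divide)
  qed
  have "real (card X) * ((real (card Y))\<^sup>2 / 2) \<le> (\<Sum>x\<in>X. (cmod (S (f x)))\<^sup>2)"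
    using sum_mono[OF big] by simp
  also have "\<dots> = (\<Sum>t\<in>f ` X. (cmod (S t))\<^sup>2)" using injf by (simp add: sum.reindex)
  also have "\<dots> \<le> (\<Sum>t<p. (cmod (S t))\<^sup>2)" using fX by (intro sum_mono2) auto
  also have "\<dots> = real p * real (card Y)" unfolding S_def using sum_norm_square_expsum[OF p Y] .
  finally have "(real (card X) * real (card Y)) * real (card Y) \<le> (2 * real p) * real (card Y)"
    by (simp add: power2_eq_square)
  then have "real (card X) * real (card Y) \<le> 2 * real p" using False by simp
  then show ?thesis by (metis of_nat_le_iff of_nat_mult of_nat_numeral)
qed simp

section \<open>Slowly growing sumsets of integers\<close>

text \<open>In the first alternative the size is gained twice: from \<open>s\<close> separated
  points modulo \<open>L\<close> and from the shifts by \<open>0, L, ..., k * L\<close>. In the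
  second the balls modulo \<open>L\<close> stop growing early, so that one of them already covers
  the group generated by \<open>D\<close>, and \<open>g\<close> generates that group.\<close>

lemma sumball_growth:
  fixes D :: "int set" and L :: int and s k :: nat
  assumes fin: "finite D" and D0: "0 \<in> D" and sym: "\<And>d. d \<in> D \<Longrightarrow> - d \<in> D"
    and L: "L \<in> D" "L > 0" and bd: "\<And>d. d \<in> D \<Longrightarrow> \<bar>d\<bar> \<le> L"
  shows "s * (k + 1) * card D \<le> 4 * card (sumball D (3 * s + k)) \<or>
    (\<exists>g>0. (\<forall>d\<in>D. g dvd d) \<and> (\<forall>i. \<bar>i * g\<bar> \<le> L \<longrightarrow> i * g \<in> sumball D (6 * s + 1)))"
proof -
  txt \<open>
    Work in the word metric that \<open>D\<close> induces on the integers modulo \<open>L\<close>. If some point has distance at least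
    \<open>3 * s\<close> from \<open>0\<close>, then points \<open>z i\<close> at distance \<open>3 * i\<close> have disjoint translates \<open>z i + D\<close>, which makes
    the sumset large.
  \<close>
  define Q where "Q n = {x. \<exists>j. x + j * L \<in> sumball D n}" for n
  have mono: "m \<le> n \<Longrightarrow> x \<in> sumball D m \<Longrightarrow> x \<in> sumball D n" for m n x
    using sumball_mono[OF D0, of m n] by blast
  have multL: "j * L \<in> sumball D (nat \<bar>j\<bar>)" for j
  proof (cases "j \<ge> 0")
    case True
    then show ?thesis using sumball_mult[OF L(1), of "nat j"] by simp
  next
    case False
    then show ?thesis using sumball_mult[OF sym[OF L(1)], of "nat (- j)"] by simp
  qed
  show ?thesis
  proof (cases "\<exists>n<3 * s. Q (Suc n) \<subseteq> Q n")
    case True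
    then obtain n where n: "n < 3 * s" "Q (Suc n) \<subseteq> Q n" by blast
    \<comment> \<open>A ball that once fails to grow never grows again: modulo \<open>L\<close>, all
      sums of elements of \<open>D\<close> lie within distance \<open>n\<close> of 0.\<close>
    have stab: "sumball D m \<subseteq> Q n" for m
    proof (induction m)
      case 0
      show ?case using sumball_mono[OF D0, of 0 n] unfolding Q_def by (auto intro: exI[of _ 0])
    next
      case (Suc m)
      show ?case
      proof
        fix x assume "x \<in> sumball D (Suc m)"
        then obtain w d where w: "w \<in> sumball D m" "d \<in> D" "x = w + d" by auto
        then obtain j where "w + j * L \<in> sumball D n" using Suc unfolding Q_def by blast
        then have "(w + j * L) + d \<in> sumball D (Suc n)" using w by (intro sumball_SucI)
        then have "x + j * L \<in> sumball D (Suc n)" using w by (simp add: algebra_simps)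
        then show "x \<in> Q n" using n(2) unfolding Q_def by blast
      qed
    qed
    \<comment> \<open>The group generated by \<open>D\<close>; its least positive element
      \<open>h\<close> will serve as \<open>g\<close>.\<close>
    define G where "G = (\<Union>m. sumball D m)"
    have Gadd: "x + y \<in> G" if "x \<in> G" "y \<in> G" for x y
      using that sumball_add unfolding G_def by blast
    have Gneg: "- x \<in> G" if "x \<in> G" for x
      using that sumball_uminus[OF sym] unfolding G_def by blast
    have G0: "0 \<in> G" unfolding G_def by (auto intro: exI[of _ 0])
    have DG: "D \<subseteq> G"
    proof
      fix d assume "d \<in> D"
      then have "d \<in> sumball D (Suc 0)" using sumball_SucI[of 0 D 0 d] by simp
      then show "d \<in> G" unfolding G_def by blast
    qed
    have Gnat: "int i * x \<in> G" if "x \<in> G" for i x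
      by (induction i) (use G0 Gadd that in \<open>auto simp: algebra_simps\<close>)
    have Gint: "i * x \<in> G" if "x \<in> G" for i x
    proof (cases "i \<ge> 0")
      case True
      then show ?thesis using Gnat[OF that, of "nat i"] by simp
    next
      case False
      then show ?thesis using Gneg[OF Gnat[OF that, of "nat (- i)"]] by simp
    qed
    define h where "h = (LEAST k. k > 0 \<and> int k \<in> G)"
    have "nat L > 0 \<and> int (nat L) \<in> G" using L DG by auto
    then have h: "h > 0" "int h \<in> G" unfolding h_def by (metis (mono_tags, lifting) LeastI)+
    have hleast: "h \<le> k" if "k > 0" "int k \<in> G" for k
      unfolding h_def using that by (intro Least_le) auto
    have hdvd: "int h dvd d" if "d \<in> D" for d
    proof (rule ccontr)
      assume nd: "\<not> int h dvd d"
      have "d mod int h = d + (- (d div int h)) * int h" by (simp add: minus_div_mult_eq_mod[symmetric])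
      moreover have "\<dots> \<in> G" using that DG by (intro Gadd Gint h) auto
      ultimately have "d mod int h \<in> G" by simp
      moreover have "int (nat (d mod int h)) = d mod int h" using h(1) by simp
      ultimately have "int (nat (d mod int h)) \<in> G" by (simp only:)
      moreover have "nat (d mod int h) > 0"
        using mod_0_imp_dvd[of d "int h"] nd pos_mod_sign[of "int h" d] h(1) by linarith
      ultimately have "h \<le> nat (d mod int h)" using hleast by blast
      then show False using h(1) pos_mod_bound[of "int h" d] by linarith
    qed
    \<comment> \<open>Modulo \<open>L\<close> this multiple lies in the ball of radius
      \<open>3 * s\<close>, whose elements are at most \<open>3 * s * L\<close> in absolute value.
      So the shift \<open>j * L\<close> to be undone has
      \<open>\<bar>j\<bar> \<le> 3 * s + 1\<close>, and the radii add up to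
      \<open>6 * s + 1\<close>.\<close>
    have "i * int h \<in> sumball D (6 * s + 1)" if i: "\<bar>i * int h\<bar> \<le> L" for i
    proof -
      have "i * int h \<in> Q n" using Gint[OF h(2), of i] stab unfolding G_def by blast
      then obtain j where "i * int h + j * L \<in> sumball D n" unfolding Q_def by blast
      then have j: "i * int h + j * L \<in> sumball D (3 * s)" using mono n(1) by (meson less_imp_le)
      then have "\<bar>i * int h + j * L\<bar> \<le> int (3 * s) * L" using abs_sumball_le[OF bd] by blast
      then have "\<bar>j * L\<bar> \<le> (int (3 * s) + 1) * L" using i by (simp add: algebra_simps)
      then have "\<bar>j\<bar> \<le> int (3 * s) + 1" using L(2) by (simp add: abs_mult)
      then have "nat \<bar>- j\<bar> \<le> 3 * s + 1" by simp
      then have "- j * L \<in> sumball D (3 * s + 1)" using multL mono by blast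
      then have "(i * int h + j * L) + - j * L \<in> sumball D (3 * s + (3 * s + 1))"
        using j by (intro sumball_add)
      then show ?thesis by (simp add: algebra_simps)
    qed
    then show ?thesis using hdvd h(1) by (intro disjI2 exI[of _ "int h"]) auto
  next
    case False
    \<comment> \<open>Growth at radius \<open>3 * i - 1\<close> yields a point at distance exactly
      \<open>3 * i\<close> from 0 modulo \<open>L\<close>.\<close>
    have "\<exists>z. z \<in> sumball D (3 * i) \<and> (i > 0 \<longrightarrow> z \<notin> Q (3 * i - 1))" if "i < s" for i
    proof (cases i)
      case 0
      then show ?thesis by simp
    next
      case (Suc i')
      then have "Suc (3 * i - 1) = 3 * i" by simp
      moreover have "\<not> Q (Suc (3 * i - 1)) \<subseteq> Q (3 * i - 1)" using False that Suc by auto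
      ultimately obtain z where z: "z \<in> Q (3 * i)" "z \<notin> Q (3 * i - 1)" by (metis subsetI)
      then obtain j where j: "z + j * L \<in> sumball D (3 * i)" unfolding Q_def by blast
      have "z + j * L \<notin> Q (3 * i - 1)"
      proof
        assume "z + j * L \<in> Q (3 * i - 1)"
        then obtain j' where "z + j * L + j' * L \<in> sumball D (3 * i - 1)" unfolding Q_def by blast
        then have "z + (j + j') * L \<in> sumball D (3 * i - 1)" by (simp add: algebra_simps)
        then show False using z(2) unfolding Q_def by blast
      qed
      then show ?thesis using j by blast
    qed
    then obtain z where z: "\<And>i. i < s \<Longrightarrow> z i \<in> sumball D (3 * i)"
      "\<And>i. i < s \<Longrightarrow> i > 0 \<Longrightarrow> z i \<notin> Q (3 * i - 1)" by metis
    \<comment> \<open>Elements of \<open>[0, L)\<close> stay distinct modulo \<open>L\<close>.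
      Together with their negatives and \<open>L\<close>, \<open>- L\<close> they exhaust
      \<open>D\<close>, whence the factor 4.\<close>
    define D' where "D' = {d \<in> D. 0 \<le> d \<and> d < L}"
    have D'D: "D' \<subseteq> D" unfolding D'_def by blast
    define F where "F = (\<lambda>(i, d, t). z i + d + int t * L)"
    \<comment> \<open>A coincidence would lead from \<open>z i'\<close> to \<open>z i\<close> modulo
      \<open>L\<close> in two steps, placing \<open>z i\<close> within
      \<open>3 * i' + 2 \<le> 3 * i - 1\<close> steps of 0. The spacing 3 is made for this.\<close>
    have lt: False if "i' < i" "i < s" "d \<in> D'" "d' \<in> D'" "z i + d + int t * L = z i' + d' + int t' * L"
      for i i' d d' t t'
    proof -
      have "z i' + d' + - d \<in> sumball D (Suc (Suc (3 * i')))"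
        using that D'D z(1)[of i'] sym by (intro sumball_SucI) auto
      then have "z i' + d' + - d \<in> sumball D (3 * i - 1)" using that(1) by (elim mono[rotated]) simp
      moreover have "z i + (int t - int t') * L = z i' + d' + - d" using that(5) by (simp add: algebra_simps)
      ultimately have "z i \<in> Q (3 * i - 1)" unfolding Q_def by (metis (mono_tags, lifting) mem_Collect_eq)
      then show False using z(2)[of i] that by auto
    qed
    have inj: "inj_on F ({..<s} \<times> D' \<times> {..k})"
    proof (rule inj_onI)
      fix u v assume uv: "u \<in> {..<s} \<times> D' \<times> {..k}" "v \<in> {..<s} \<times> D' \<times> {..k}" "F u = F v"
      obtain i d t where u: "u = (i, d, t)" by (metis prod_cases3)
      obtain i' d' t' where v: "v = (i', d', t')" by (metis prod_cases3)
      have eq: "z i + d + int t * L = z i' + d' + int t' * L" using uv(3) unfolding u v F_def by simp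
      have ii: "i = i'" using lt[of i' i d d' t t'] lt[of i i' d' d t' t] eq uv(1,2) unfolding u v
        by (metis linorder_neqE_nat mem_Sigma_iff lessThan_iff)
      then have "d - d' = (int t' - int t) * L" using eq by (simp add: algebra_simps)
      then have "L dvd d - d'" by simp
      moreover have "\<bar>d - d'\<bar> < L" using uv(1,2) unfolding u v D'_def by auto
      ultimately have dd: "d = d'"
        using dvd_imp_le_int[of "d - d'" L] L(2) by (cases "d = d'") auto
      then have "t = t'" using eq ii L(2) by simp
      then show "u = v" using u v ii dd by simp
    qed
    have img: "F ` ({..<s} \<times> D' \<times> {..k}) \<subseteq> sumball D (3 * s + k)"
    proof (clarsimp simp: F_def)
      fix i d t assume a: "i < s" "d \<in> D'" "t \<le> k"
      have "z i + d \<in> sumball D (Suc (3 * i))" using a D'D z(1) by (intro sumball_SucI) auto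
      moreover have "int t * L \<in> sumball D t" using sumball_mult[OF L(1)] .
      ultimately have "z i + d + int t * L \<in> sumball D (Suc (3 * i) + t)" by (rule sumball_add)
      then show "z i + d + int t * L \<in> sumball D (3 * s + k)" using a by (elim mono[rotated]) simp
    qed
    have finD': "finite D'" using fin D'D finite_subset by blast
    have "card ({..<s} \<times> D' \<times> {..k}) \<le> card (sumball D (3 * s + k))"
      using card_inj_on_le[OF inj img finite_sumball[OF fin]] .
    then have c1: "s * (card D' * (k + 1)) \<le> card (sumball D (3 * s + k))" by (simp add: card_cartesian_product)
    have "D \<subseteq> D' \<union> uminus ` D' \<union> {L, - L}"
    proof
      fix d assume d: "d \<in> D"
      show "d \<in> D' \<union> uminus ` D' \<union> {L, - L}"
      proof (cases "\<bar>d\<bar> = L")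
        case True
        then show ?thesis by auto
      next
        case False
        then have "\<bar>d\<bar> < L" using bd[OF d] by simp
        then have "d \<in> D' \<or> - d \<in> D'" using d sym[OF d] unfolding D'_def by auto
        then show ?thesis by (auto simp: image_iff intro: bexI[of _ "- d"])
      qed
    qed
    then have "card D \<le> card (D' \<union> uminus ` D' \<union> {L, - L})" using finD' by (intro card_mono) auto
    also have "\<dots> \<le> card D' + card (uminus ` D') + card {L, - L}"
      by (meson card_Un_le le_trans add_le_mono1)
    also have "\<dots> \<le> card D' + card D' + 2"
      by (intro add_mono card_image_le finD' order_refl) (simp add: card_insert_if)
    also have "\<dots> \<le> 4 * card D'"
    proof -
      have "0 \<in> D'" using D0 L(2) unfolding D'_def by simp
      then have "card D' \<ge> 1" using finD' by (metis One_nat_def Suc_leI card_gt_0_iff empty_iff)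
      then show ?thesis by simp
    qed
    finally have "s * (k + 1) * card D \<le> s * (k + 1) * (4 * card D')" by (rule mult_left_mono) simp
    also have "\<dots> \<le> 4 * card (sumball D (3 * s + k))" using c1 by (simp add: algebra_simps)
    finally show ?thesis by blast
  qed
qed

section \<open>Each factor lies in a short progression\<close>

lemma prime_inverse_mod:
  fixes p :: nat and b :: int
  assumes "prime p" "\<not> int p dvd b"
  obtains c where "[b * c = 1] (mod int p)"
proof -
  have "coprime b (int p)"
    using assms by (metis coprime_commute prime_imp_coprime prime_nat_int_transfer)
  then show ?thesis using that cong_solve_coprime_int by blast
qed

lemma cong_mult_cancel_prime:
  fixes p :: nat and b :: int
  assumes "prime p" "\<not> int p dvd b" "[x * b = y * b] (mod int p)"
  shows "[x = y] (mod int p)"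
proof -
  have "coprime b (int p)"
    using assms by (metis coprime_commute prime_imp_coprime prime_nat_int_transfer)
  then show ?thesis using assms(3) by (simp add: cong_mult_rcancel)
qed

definition diff_set :: "int set \<Rightarrow> int set" where
  "diff_set A = {a - a' |a a'. a \<in> A \<and> a' \<in> A}"

text \<open>Multiplying the differences by one \<open>b\<close> in \<open>B\<close> moves them to a
  set \<open>D\<close> of integers in \<open>[-N, N]\<close>. Fast growth of the sumsets of
  \<open>D\<close> would violate \<open>card_mult_le_of_small_products\<close>, so
  \<open>sumball_growth\<close> yields a full progression with difference \<open>g\<close>.
  Multiplying back by the inverse \<open>c\<close> of \<open>b\<close> gives
  \<open>u = g * c\<close>, with \<open>l = L / g\<close>.\<close>

lemma factor_in_progression:
  fixes p :: nat and A B :: "int set" and N :: int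
  assumes p: "prime p" and A: "A \<subseteq> {0..<int p}" "card A \<ge> 2"
    and B: "B \<subseteq> {0<..<int p}" "B \<noteq> {}"
    and sm: "\<And>d b. d \<in> diff_set A \<Longrightarrow> b \<in> B \<Longrightarrow> small_mod (int p) N (d * b)"
    and N: "N \<ge> 1" "N \<le> 2 * int (card A) * int (card B)" "14400 * N \<le> int p"
  shows "\<exists>u l. \<not> int p dvd u \<and> l > 0 \<and> int (card A) \<le> 2 * l + 1 \<and>
    (\<forall>d\<in>diff_set A. \<exists>i. \<bar>i\<bar> \<le> l \<and> [d = u * i] (mod int p)) \<and>
    (\<forall>i. \<bar>i\<bar> \<le> l \<longrightarrow> (\<exists>x\<in>sumball (diff_set A) 1801. [x = u * i] (mod int p)))"
proof -
  have p0: "p > 0" using p by (simp add: prime_gt_0_nat)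
  have finA: "finite A" and finB: "finite B" using A B finite_subset by blast+
  obtain b where b: "b \<in> B" using B by blast
  have nd: "\<not> int p dvd b'" if "b' \<in> B" for b'
    using that B(1) zdvd_not_zless[of b' "int p"] by auto
  obtain c where c: "[b * c = 1] (mod int p)" using prime_inverse_mod[OF p nd[OF b]] .
  have ndc: "\<not> int p dvd c"
  proof
    assume "int p dvd c"
    then have "int p dvd b * c" by simp
    then have "int p dvd 1" using c by (metis cong_dvd_iff)
    then show False using p by (simp add: prime_nat_iff)
  qed
  define D where "D = {y. \<bar>y\<bar> \<le> N \<and> (\<exists>d\<in>diff_set A. [d * b = y] (mod int p))}"
  have finD: "finite D" by (rule finite_subset[of _ "{-N..N}"]) (auto simp: D_def)
  obtain a0 where a0: "a0 \<in> A" using A(2) by fastforce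
  have "0 \<in> diff_set A" unfolding diff_set_def using a0 by force
  then have D0: "0 \<in> D" unfolding D_def using N(1) by (auto intro: bexI[of _ 0])
  have sym: "- y \<in> D" if y: "y \<in> D" for y
  proof -
    obtain d where d: "d \<in> diff_set A" "[d * b = y] (mod int p)" using y unfolding D_def by blast
    have "[- d * b = - y] (mod int p)" using d(2) by (simp add: cong_minus_minus_iff)
    moreover have "- d \<in> diff_set A" using d(1) unfolding diff_set_def by force
    ultimately show ?thesis using y unfolding D_def by fastforce
  qed
  have exD: "\<exists>y\<in>D. [d * b = y] (mod int p)" if "d \<in> diff_set A" for d
    using sm[OF that b] that unfolding small_mod_def D_def by blast
  have cardAD: "card A \<le> card D"
  proof -
    have "\<exists>f. \<forall>a\<in>A. f a \<in> D \<and> [(a - a0) * b = f a] (mod int p)"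
      using exD a0 unfolding diff_set_def by (intro bchoice ballI) blast
    then obtain f where f: "\<And>a. a \<in> A \<Longrightarrow> f a \<in> D" "\<And>a. a \<in> A \<Longrightarrow> [(a - a0) * b = f a] (mod int p)" by blast
    have "inj_on f A"
    proof (rule inj_onI)
      fix x y assume xy: "x \<in> A" "y \<in> A" "f x = f y"
      have "[(x - a0) * b = (y - a0) * b] (mod int p)"
        using f(2)[OF xy(1)] f(2)[OF xy(2)] xy(3) by (metis cong_trans cong_sym)
      then have "[x - a0 = y - a0] (mod int p)" using cong_mult_cancel_prime[OF p nd[OF b]] by blast
      then have "[x = y] (mod int p)" using cong_add[OF _ cong_refl, of "x - a0" "y - a0" "int p" a0] by simp
      then show "x = y" using xy A(1) by (auto simp: cong_def subset_iff)
    qed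
    then show ?thesis using f(1) finD by (intro card_inj_on_le[of f]) auto
  qed
  define L where "L = Max D"
  have LD: "L \<in> D" unfolding L_def using finD D0 by (intro Max_in) auto
  have bd: "\<bar>d\<bar> \<le> L" if "d \<in> D" for d
    using Max_ge[OF finD that] Max_ge[OF finD sym[OF that]] unfolding L_def by linarith
  have L0: "L > 0"
  proof (rule ccontr)
    assume "\<not> L > 0"
    then have "D \<subseteq> {0}" using bd by force
    then have "card D \<le> 1" using card_mono[of "{0}" D] by simp
    then show False using cardAD A(2) by simp
  qed
  have LN: "L \<le> N" using LD unfolding D_def by auto
  have lift: "\<exists>w\<in>sumball (diff_set A) n. [w * b = x] (mod int p)" if "x \<in> sumball D n" for x n
    using that
  proof (induction n arbitrary: x)
    case 0
    then show ?case by simp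
  next
    case (Suc n)
    then obtain z y where z: "z \<in> sumball D n" "y \<in> D" "x = z + y" by auto
    obtain w where w: "w \<in> sumball (diff_set A) n" "[w * b = z] (mod int p)" using Suc.IH[OF z(1)] by blast
    obtain d where d: "d \<in> diff_set A" "[d * b = y] (mod int p)" using z(2) unfolding D_def by blast
    have "[(w + d) * b = x] (mod int p)" using cong_add[OF w(2) d(2)] z(3) by (simp add: algebra_simps)
    then show ?case using sumball_SucI[OF w(1) d(1)] by blast
  qed
  have cancel: "[w = x * c] (mod int p)" if "[w * b = x] (mod int p)" for w x
  proof -
    have "[w * b * c = x * c] (mod int p)" using that by (rule cong_scalar_right)
    moreover have "[w * (b * c) = w * 1] (mod int p)" using c by (rule cong_scalar_left)
    ultimately show ?thesis by (metis cong_sym cong_trans mult.assoc mult.right_neutral)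
  qed
  txt \<open>The threshold \<open>s = 300\<close> in \<open>sumball_growth\<close> contradicts the Fourier bound; \<open>1801 = 6 * 300 + 1\<close>.\<close>
  define k where "k = nat (int p div (16 * N))"
  have kint: "int k = int p div (16 * N)" unfolding k_def using N(1) by (simp add: pos_imp_zdiv_nonneg_iff)
  have pk: "16 * (int k * N) + int p mod (16 * N) = int p"
    using div_mult_mod_eq[of "int p" "16 * N"] unfolding kint by (simp add: mult_ac)
  have pr: "0 \<le> int p mod (16 * N)" "int p mod (16 * N) < 16 * N" using N(1) by simp_all
  have k1: "16 * int k * N \<le> int p" using pk pr(1) by simp
  have k2: "int p < 16 * (int k + 1) * N" using pk pr(2) by (simp add: algebra_simps)
  have nocase: "\<not> 300 * (k + 1) * card D \<le> 4 * card (sumball D (3 * 300 + k))"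
  proof
    assume le: "300 * (k + 1) * card D \<le> 4 * card (sumball D (3 * 300 + k))"
    define X where "X = sumball D (900 + k)"
    define M where "M = int (900 + k) * N"
    \<comment> \<open>Each summand of \<open>900 + k\<close> costs at most half of \<open>p\<close>:
      \<open>16 * 900 = 14400\<close>, and \<open>16 * k * N \<le> p\<close> by the choice of
      \<open>k\<close>.\<close>
    have M8: "8 * M \<le> int p" unfolding M_def using k1 N(3) by (simp add: algebra_simps)
    have Xb: "\<bar>x\<bar> \<le> M" if "x \<in> X" for x
      using abs_sumball_le[of D N x "900 + k"] that unfolding X_def M_def D_def by blast
    have M0: "M > 0" unfolding M_def using N(1) by simp
    have injX: "inj_on (\<lambda>x. x mod int p) X"
    proof (rule inj_onI)
      fix x y assume xy: "x \<in> X" "y \<in> X" "x mod int p = y mod int p"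
      show "x = y" using xy(3) Xb[OF xy(1)] Xb[OF xy(2)] M8 M0
        by (intro cong_small_imp_eq[of x y "int p" M M]) (auto simp: cong_def)
    qed
    have injc: "b1 = b2" if "b1 \<in> B" "b2 \<in> B" "[b1 * c = b2 * c] (mod int p)" for b1 b2
    proof -
      have "[b1 = b2] (mod int p)" using cong_mult_cancel_prime[OF p ndc that(3)] .
      then show ?thesis using that(1,2) B(1) by (intro cong_less_imp_eq_int[of b1 "int p" b2]) auto
    qed
    \<comment> \<open>Elements of \<open>X\<close> carry the factor \<open>b\<close>, so
      \<open>B\<close> is divided by \<open>b\<close>: the products become those of sums of
      differences with elements of \<open>B\<close>.\<close>
    define Y where "Y = (\<lambda>b'. b' * c) ` B"
    have cY: "card Y = card B" unfolding Y_def using injc by (intro card_image inj_onI) auto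
    have injY: "inj_on (\<lambda>y. y mod int p) Y"
      unfolding Y_def using injc by (intro inj_onI) (auto simp: cong_def)
    have "card X * card Y \<le> 2 * p"
    proof (rule card_mult_le_of_small_products[OF p0 _ injX _ injY _ M8])
      show "finite X" unfolding X_def using finite_sumball[OF finD] .
      show "finite Y" unfolding Y_def using finB by simp
      fix x y assume x: "x \<in> X" and y: "y \<in> Y"
      obtain b' where b': "b' \<in> B" "y = b' * c" using y unfolding Y_def by blast
      obtain w where w: "w \<in> sumball (diff_set A) (900 + k)" "[w * b = x] (mod int p)"
        using lift x unfolding X_def by blast
      have "small_mod (int p) (int (900 + k) * N) (b' * w)"
        using small_mod_sumball[of "diff_set A" "int p" N b' w "900 + k"] sm b'(1) w(1) by (simp add: mult.commute)
      then obtain v where v: "\<bar>v\<bar> \<le> M" "[b' * w = v] (mod int p)" unfolding small_mod_def M_def by blast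
      have "[b' * (x * c) = b' * w] (mod int p)" using cong_scalar_left[OF cong_sym[OF cancel[OF w(2)]]] .
      then have "[x * y = v] (mod int p)" using v(2) b'(2) by (metis cong_trans mult.left_commute)
      then show "small_mod (int p) M (x * y)" using v(1) unfolding small_mod_def by blast
    qed
    then have XB: "card X * card B \<le> 2 * p" using cY by simp
    have "300 * (k + 1) * card A * card B \<le> 300 * (k + 1) * card D * card B"
      using cardAD by (intro mult_mono) auto
    also have "\<dots> \<le> 4 * card X * card B" using le unfolding X_def by (intro mult_right_mono) auto
    also have "\<dots> \<le> 8 * p" using XB by (simp add: mult.commute)
    finally have "int (300 * (k + 1) * card A * card B) \<le> int (8 * p)" by (simp only: of_nat_le_iff)
    then have "300 * (int k + 1) * (2 * int (card A) * int (card B)) \<le> 16 * int p" by (simp add: algebra_simps)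
    moreover have "300 * (int k + 1) * N \<le> 300 * (int k + 1) * (2 * int (card A) * int (card B))"
      using N(2) by (intro mult_left_mono) auto
    \<comment> \<open>Against this, \<open>16 * p < 256 * (k + 1) * N\<close>; the value 300 only
      has to beat 256.\<close>
    ultimately have "300 * ((int k + 1) * N) \<le> 16 * int p" by (simp add: algebra_simps)
    moreover have "int p < 16 * ((int k + 1) * N)" using k2 by (simp add: algebra_simps)
    ultimately show False by linarith
  qed
  obtain g where g: "g > 0" "\<And>d. d \<in> D \<Longrightarrow> g dvd d"
    "\<And>i. \<bar>i * g\<bar> \<le> L \<Longrightarrow> i * g \<in> sumball D (6 * 300 + 1)"
    using sumball_growth[OF finD D0 sym LD L0 bd, of 300 k] nocase by blast
  obtain l where l: "L = g * l" using g(2)[OF LD] by (auto elim: dvdE)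
  have l0: "l > 0" using l L0 g(1) by (simp add: zero_less_mult_iff)
  have ib: "\<bar>i * g\<bar> \<le> L \<longleftrightarrow> \<bar>i\<bar> \<le> l" for i
    unfolding l using g(1) by (simp add: abs_mult mult.commute[of g])
  have rep: "\<exists>i. \<bar>i\<bar> \<le> l \<and> y = i * g" if "y \<in> D" for y
    using g(2)[OF that] bd[OF that] ib by (auto elim!: dvdE simp: mult.commute)
  have "D \<subseteq> (\<lambda>i. i * g) ` {-l..l}" using rep by fastforce
  then have "card D \<le> card {-l..l}" by (meson card_image_le card_mono finite_atLeastAtMost_int finite_imageI le_trans)
  then have cl: "int (card A) \<le> 2 * l + 1" using cardAD l0 by simp
  have "\<not> int p dvd g"
  proof -
    have "g \<le> L" using g(1,2) LD L0 by (simp add: zdvd_imp_le)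
    then have "g < int p" using LN N by linarith
    then show ?thesis using g(1) by (auto dest: zdvd_imp_le)
  qed
  then have "\<not> int p dvd g * c" using ndc p by (simp add: prime_dvd_mult_iff)
  moreover have "\<exists>i. \<bar>i\<bar> \<le> l \<and> [d = g * c * i] (mod int p)" if d: "d \<in> diff_set A" for d
  proof -
    obtain y where y: "y \<in> D" "[d * b = y] (mod int p)" using exD[OF d] by blast
    obtain i where i: "\<bar>i\<bar> \<le> l" "y = i * g" using rep[OF y(1)] by blast
    show ?thesis using cancel[OF y(2)] i by (auto simp: mult_ac)
  qed
  moreover have "\<exists>x\<in>sumball (diff_set A) 1801. [x = g * c * i] (mod int p)" if i: "\<bar>i\<bar> \<le> l" for i
  proof -
    have "i * g \<in> sumball D 1801" using g(3)[of i] ib i by simp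
    then obtain w where w: "w \<in> sumball (diff_set A) 1801" "[w * b = i * g] (mod int p)" using lift by blast
    then show ?thesis using cancel[OF w(2)] by (auto simp: mult_ac)
  qed
  ultimately show ?thesis using l0 cl by blast
qed

section \<open>Lifting the factorization to the integers\<close>

lemma small_mod_cong: "[x = y] (mod p) \<Longrightarrow> small_mod p M x \<longleftrightarrow> small_mod p M y"
  unfolding small_mod_def by (metis cong_sym cong_trans)

text \<open>Modulo \<open>p\<close>, \<open>u * i\<close> is a sum of \<open>K\<close> differences,
  so \<open>u * b * i\<close> is at most \<open>K * N\<close> in size for all
  \<open>\<bar>i\<bar> \<le> l\<close>; \<open>small_mod_multiples\<close> then gains the factor
  \<open>l\<close>.\<close>

lemma progression_times_factor:
  fixes p :: nat
  assumes sm: "\<And>d b. d \<in> diff_set A \<Longrightarrow> b \<in> B \<Longrightarrow> small_mod (int p) N (d * b)"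
    and u: "\<And>i. \<bar>i\<bar> \<le> l \<Longrightarrow> \<exists>x\<in>sumball (diff_set A) K. [x = u * i] (mod int p)"
    and l: "l > 0" and K: "3 * (int K * N) < int p" and b: "b \<in> B"
  shows "\<exists>y. [u * b = y] (mod int p) \<and> \<bar>y\<bar> * l \<le> int K * N"
proof (rule small_mod_multiples[OF l K])
  fix i assume "\<bar>i\<bar> \<le> l"
  then obtain x where x: "x \<in> sumball (diff_set A) K" "[x = u * i] (mod int p)" using u by blast
  have "small_mod (int p) (int K * N) (b * x)"
    by (rule small_mod_sumball[OF _ x(1)]) (use sm b in \<open>simp add: mult.commute\<close>)
  moreover have "[b * x = u * b * i] (mod int p)" using cong_scalar_left[OF x(2), of b] by (simp add: mult_ac)
  ultimately show "small_mod (int p) (int K * N) (u * b * i)" using small_mod_cong by blast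
qed

text \<open>The gain of \<open>small_mod_multiples\<close> is taken in both variables: first
  \<open>j\<close> runs up to \<open>l'\<close> with \<open>i\<close> fixed, then \<open>i\<close>
  runs up to \<open>l\<close>.\<close>

lemma progression_steps_product:
  fixes p :: nat
  assumes sm: "\<And>d e. d \<in> diff_set A \<Longrightarrow> e \<in> diff_set B \<Longrightarrow> small_mod (int p) N (d * e)"
    and u: "\<And>i. \<bar>i\<bar> \<le> l \<Longrightarrow> \<exists>x\<in>sumball (diff_set A) K. [x = u * i] (mod int p)"
    and v: "\<And>i. \<bar>i\<bar> \<le> l' \<Longrightarrow> \<exists>x\<in>sumball (diff_set B) K. [x = v * i] (mod int p)"
    and l: "l > 0" "l' > 0" and K: "3 * (int K * (int K * N)) < int p" and N: "N \<ge> 0"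
  shows "\<exists>g. [u * v = g] (mod int p) \<and> \<bar>g\<bar> * l * l' \<le> int K * (int K * N)"
proof -
  define M where "M = int K * (int K * N)"
  have M0: "M \<ge> 0" unfolding M_def using N by simp
  have uvij: "small_mod (int p) M (u * i * v * j)" if ij: "\<bar>i\<bar> \<le> l" "\<bar>j\<bar> \<le> l'" for i j
  proof -
    obtain x where x: "x \<in> sumball (diff_set A) K" "[x = u * i] (mod int p)" using u ij by blast
    obtain y where y: "y \<in> sumball (diff_set B) K" "[y = v * j] (mod int p)" using v ij by blast
    have xe: "small_mod (int p) (int K * N) (x * e)" if e: "e \<in> diff_set B" for e
    proof -
      have "small_mod (int p) (int K * N) (e * x)"
        by (rule small_mod_sumball[OF _ x(1)]) (use sm e in \<open>simp add: mult.commute\<close>)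
      then show ?thesis by (simp add: mult.commute)
    qed
    have "small_mod (int p) M (x * y)" unfolding M_def using small_mod_sumball[OF xe y(1)] .
    moreover have "[x * y = u * i * v * j] (mod int p)" using cong_mult[OF x(2) y(2)] by (simp add: mult_ac)
    ultimately show ?thesis using small_mod_cong by blast
  qed
  have *: "small_mod (int p) (M div l') (u * v * i)" if i: "\<bar>i\<bar> \<le> l" for i
  proof -
    have "\<exists>y. [u * i * v = y] (mod int p) \<and> \<bar>y\<bar> * l' \<le> M"
      by (rule small_mod_multiples[OF l(2)]) (use K M_def uvij[OF i] in auto)
    then obtain y where y: "[u * i * v = y] (mod int p)" "\<bar>y\<bar> * l' \<le> M" by blast
    have "\<bar>y\<bar> \<le> M div l'" using zdiv_mono1[OF y(2) l(2)] l(2) by simp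
    then show ?thesis unfolding small_mod_def using y(1) by (auto simp: mult_ac)
  qed
  have Ml: "(M div l') * l' \<le> M"
    using div_mult_mod_eq[of M l'] pos_mod_sign[OF l(2), of M] by linarith
  have "M div l' \<le> M" using M0 l(2) by (metis div_by_1 int_one_le_iff_zero_less zdiv_mono2 zero_less_one)
  then have "3 * (M div l') < int p" using K unfolding M_def by linarith
  then obtain g where g: "[u * v = g] (mod int p)" "\<bar>g\<bar> * l \<le> M div l'"
    using small_mod_multiples[OF l(1) _ *] by blast
  have "\<bar>g\<bar> * l * l' \<le> (M div l') * l'" using g(2) l(2) by (intro mult_right_mono) auto
  then have "\<bar>g\<bar> * l * l' \<le> M" using Ml by linarith
  then show ?thesis using g(1) unfolding M_def by blast
qed

text \<open>Each factor is multiplied by the step belonging to the other one: a difference in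
  \<open>A\<close> is \<open>u * i\<close>, so differences in \<open>v * A\<close> are multiples of
  \<open>g = u * v\<close>, and likewise for \<open>u * B\<close>. All representatives are far below
  \<open>p\<close>, so the congruences become equalities and \<open>integer_ap_product\<close>
  applies.\<close>

lemma mod_interval_factorization:
  fixes p N :: nat and A B :: "int set" and n :: int
  assumes p: "prime p" and A: "A \<subseteq> {0<..<int p}" "card A \<ge> 2"
    and B: "B \<subseteq> {0<..<int p}" "card B \<ge> 2"
    and AB: "{a * b mod int p |a b. a \<in> A \<and> b \<in> B} = {(n + int i) mod int p |i. 1 \<le> i \<and> i \<le> N} - {0}"
    and N: "N \<ge> 1" "10 ^ 10 * N \<le> p"
  shows "(\<exists>r. A = {(- r) mod int p, r mod int p}) \<or> (\<exists>r. B = {(- r) mod int p, r mod int p}) \<or>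
    (N = 3 \<and> ([3 * (n + 2) = 1] (mod int p) \<or> [3 * (n + 2) = - 1] (mod int p)))"
proof -
  have p0: "int p > 0" using p by (simp add: prime_gt_0_nat)
  have finA: "finite A" and finB: "finite B" using A B finite_subset by blast+
  have ndA: "\<not> int p dvd a" if "a \<in> A" for a using that A(1) zdvd_not_zless[of a "int p"] by auto
  have ndB: "\<not> int p dvd b" if "b \<in> B" for b using that B(1) zdvd_not_zless[of b "int p"] by auto
  have pint: "prime (int p)" using p by simp
  have idx: "\<exists>i. 1 \<le> i \<and> i \<le> N \<and> [a * b = n + int i] (mod int p)" if "a \<in> A" "b \<in> B" for a b
  proof -
    have "a * b mod int p \<in> {(n + int i) mod int p |i. 1 \<le> i \<and> i \<le> N} - {0}"
      using that unfolding AB[symmetric] by blast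
    then show ?thesis unfolding cong_def by blast
  qed
  have smd: "small_mod (int p) (int N) ((a - a') * b)" if ab: "a \<in> A" "a' \<in> A" "b \<in> B" for a a' b
  proof -
    obtain i where i: "1 \<le> i" "i \<le> N" "[a * b = n + int i] (mod int p)" using idx[OF ab(1,3)] by blast
    obtain i' where i': "1 \<le> i'" "i' \<le> N" "[a' * b = n + int i'] (mod int p)" using idx[OF ab(2,3)] by blast
    have "[(a - a') * b = int i - int i'] (mod int p)" using cong_diff[OF i(3) i'(3)] by (simp add: algebra_simps)
    moreover have "\<bar>int i - int i'\<bar> \<le> int N" using i i' by linarith
    ultimately show ?thesis unfolding small_mod_def by blast
  qed
  have smd': "small_mod (int p) (int N) ((b - b') * a)" if ab: "a \<in> A" "b \<in> B" "b' \<in> B" for a b b'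
  proof -
    obtain i where i: "1 \<le> i" "i \<le> N" "[a * b = n + int i] (mod int p)" using idx[OF ab(1,2)] by blast
    obtain i' where i': "1 \<le> i'" "i' \<le> N" "[a * b' = n + int i'] (mod int p)" using idx[OF ab(1,3)] by blast
    have "[(b - b') * a = int i - int i'] (mod int p)" using cong_diff[OF i(3) i'(3)] by (simp add: algebra_simps)
    moreover have "\<bar>int i - int i'\<bar> \<le> int N" using i i' by linarith
    ultimately show ?thesis unfolding small_mod_def by blast
  qed
  have smA: "small_mod (int p) (int N) (d * b)" if "d \<in> diff_set A" "b \<in> B" for d b
    using that smd unfolding diff_set_def by blast
  have smB: "small_mod (int p) (int N) (d * a)" if "d \<in> diff_set B" "a \<in> A" for d a
    using that smd' unfolding diff_set_def by blast
  have smAB: "small_mod (int p) (2 * int N) (d * e)" if de: "d \<in> diff_set A" "e \<in> diff_set B" for d e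
  proof -
    obtain b b' where b: "b \<in> B" "b' \<in> B" "e = b - b'" using de(2) unfolding diff_set_def by blast
    obtain w where w: "\<bar>w\<bar> \<le> int N" "[d * b = w] (mod int p)" using smA[OF de(1) b(1)] unfolding small_mod_def by blast
    obtain w' where w': "\<bar>w'\<bar> \<le> int N" "[d * b' = w'] (mod int p)" using smA[OF de(1) b(2)] unfolding small_mod_def by blast
    have "[d * e = w - w'] (mod int p)" using cong_diff[OF w(2) w'(2)] b(3) by (simp add: right_diff_distrib)
    moreover have "\<bar>w - w'\<bar> \<le> 2 * int N" using w w' by linarith
    ultimately show ?thesis unfolding small_mod_def by blast
  qed
  have Np: "10 ^ 10 * int N \<le> int p" using N(2) by (metis of_nat_le_iff of_nat_mult of_nat_numeral of_nat_power)
  \<comment> \<open>Only 0 can be missing, so \<open>card A * card B \<ge> N - 1\<close>; the factor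
    2 absorbs the 1.\<close>
  have Ncard: "int N \<le> 2 * int (card A) * int (card B)"
  proof -
    have "inj_on (\<lambda>i. (n + int i) mod int p) {1..N}"
    proof (rule inj_onI)
      fix i j assume ij: "i \<in> {1..N}" "j \<in> {1..N}" "(n + int i) mod int p = (n + int j) mod int p"
      then have "[n + int i = n + int j] (mod int p)" by (simp add: cong_def)
      then have "[int i = int j] (mod int p)" by (simp only: cong_add_lcancel)
      then have "int i = int j" using ij N Np by (intro cong_small_imp_eq[of _ _ "int p" "int N" "int N"]) auto
      then show "i = j" by simp
    qed
    then have "card ((\<lambda>i. (n + int i) mod int p) ` {1..N}) = N" by (simp add: card_image)
    moreover have "(\<lambda>i. (n + int i) mod int p) ` {1..N} = {(n + int i) mod int p |i. 1 \<le> i \<and> i \<le> N}" by auto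
    ultimately have "N - 1 \<le> card ({(n + int i) mod int p |i. 1 \<le> i \<and> i \<le> N} - {0})"
      by (simp add: card_Diff_singleton_if)
    also have "\<dots> \<le> card A * card B"
    proof -
      have "{a * b mod int p |a b. a \<in> A \<and> b \<in> B} = (\<lambda>(a, b). a * b mod int p) ` (A \<times> B)" by auto
      then show ?thesis unfolding AB[symmetric]
        using card_image_le[of "A \<times> B" "\<lambda>(a, b). a * b mod int p"] finA finB by (simp add: card_cartesian_product)
    qed
    finally have "N \<le> card A * card B + 1" by linarith
    moreover have "card A * card B \<ge> 1" using A(2) B(2) by (simp add: Suc_le_eq)
    ultimately have "N \<le> 2 * card A * card B" by linarith
    then show ?thesis by (metis of_nat_le_iff of_nat_mult of_nat_numeral)
  qed
  \<comment> \<open>\<open>W\<close> is the common unit of size: all integers compared below are at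
    most \<open>90 * W\<close> in absolute value. Since \<open>10 ^ 10\<close> exceeds
    \<open>1000 * 1801^2\<close>, there is ample room below \<open>p\<close>.\<close>
  define W where "W = 1801 * (1801 * int N)"
  have N1: "int N \<ge> 1" using N(1) by simp
  have WN: "int N \<le> W" "1801 * int N \<le> W" unfolding W_def using N1 by simp_all
  have pW: "1000 * W < int p" using Np N1 unfolding W_def by simp
  obtain u l where u: "\<not> int p dvd u" and l: "l > 0" "int (card A) \<le> 2 * l + 1"
    and ud: "\<And>d. d \<in> diff_set A \<Longrightarrow> \<exists>i. \<bar>i\<bar> \<le> l \<and> [d = u * i] (mod int p)"
    and us: "\<And>i. \<bar>i\<bar> \<le> l \<Longrightarrow> \<exists>x\<in>sumball (diff_set A) 1801. [x = u * i] (mod int p)"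
  proof -
    have "A \<subseteq> {0..<int p}" "B \<noteq> {}" using A B by auto
    moreover have "14400 * int N \<le> int p" using Np by simp
    ultimately show ?thesis using that factor_in_progression[OF p _ A(2) B(1) _ smA N1 Ncard] by blast
  qed
  obtain v' l' where v': "\<not> int p dvd v'" and l': "l' > 0" "int (card B) \<le> 2 * l' + 1"
    and vd': "\<And>d. d \<in> diff_set B \<Longrightarrow> \<exists>i. \<bar>i\<bar> \<le> l' \<and> [d = v' * i] (mod int p)"
    and vs': "\<And>i. \<bar>i\<bar> \<le> l' \<Longrightarrow> \<exists>x\<in>sumball (diff_set B) 1801. [x = v' * i] (mod int p)"
  proof -
    have "B \<subseteq> {0..<int p}" "A \<noteq> {}" using A B by auto
    moreover have "int N \<le> 2 * int (card B) * int (card A)" using Ncard by (simp add: mult_ac)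
    moreover have "14400 * int N \<le> int p" using Np by simp
    ultimately show ?thesis using that factor_in_progression[OF p _ B(2) A(1) _ smB N1] by blast
  qed
  \<comment> \<open>From \<open>2 * l + 1 \<le> 3 * l\<close> for both factors, together with
    \<open>Ncard\<close>.\<close>
  have ll: "int N \<le> 18 * (l * l')"
  proof -
    have "int (card A) * int (card B) \<le> (3 * l) * (3 * l')" using l l' by (intro mult_mono) auto
    then show ?thesis using Ncard by simp
  qed
  obtain g' where g': "[u * v' = g'] (mod int p)" "\<bar>g'\<bar> * l * l' \<le> 2 * W"
    using progression_steps_product[OF smAB us vs' l(1) l'(1)] pW N1 unfolding W_def by auto
  have "g' \<noteq> 0"
  proof
    assume "g' = 0"
    then have "int p dvd u * v'" using g'(1) by (simp add: cong_0_iff)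
    then show False using u v' pint by (simp add: prime_dvd_mult_iff)
  qed
  txt \<open>Changing the sign of \<open>v'\<close> makes the common difference positive.\<close>
  define e :: int where "e = (if g' < 0 then - 1 else 1)"
  define v where "v = e * v'"
  define g where "g = e * g'"
  have ee: "e * e = 1" "\<bar>e\<bar> = 1" unfolding e_def by auto
  have g0: "g > 0" unfolding g_def e_def using \<open>g' \<noteq> 0\<close> by auto
  have guv: "[u * v = g] (mod int p)"
    using cong_scalar_left[OF g'(1), of e] unfolding v_def g_def by (simp add: mult_ac)
  have gll: "g * l * l' \<le> 2 * W"
    using g'(2) g0 ee(2) unfolding g_def by (metis abs_mult abs_of_pos mult_1)
  have v: "\<not> int p dvd v" unfolding v_def e_def using v' by auto
  have vd: "\<exists>i. \<bar>i\<bar> \<le> l' \<and> [d = v * i] (mod int p)" if d: "d \<in> diff_set B" for d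
  proof -
    obtain i where i: "\<bar>i\<bar> \<le> l'" "[d = v' * i] (mod int p)" using vd'[OF d] by blast
    have "v * (e * i) = v' * i" unfolding v_def using ee(1) by (metis mult.assoc mult.left_commute mult_1)
    moreover have "\<bar>e * i\<bar> \<le> l'" using i(1) ee(2) by (simp add: abs_mult)
    ultimately show ?thesis using i(2) by metis
  qed
  have K3: "3 * (int 1801 * int N) < int p" using Np N1 by simp
  have ub: "\<exists>y. [u * b = y] (mod int p) \<and> \<bar>y\<bar> * l \<le> 1801 * int N" if "b \<in> B" for b
    using progression_times_factor[OF smA us l(1) K3 that] by simp
  have va: "\<exists>x. [v * a = x] (mod int p) \<and> \<bar>x\<bar> * l' \<le> 1801 * int N" if a: "a \<in> A" for a
  proof -
    obtain x where x: "[v' * a = x] (mod int p)" "\<bar>x\<bar> * l' \<le> 1801 * int N"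
      using progression_times_factor[OF smB vs' l'(1) K3 a] by auto
    have "[v * a = e * x] (mod int p)" using cong_scalar_left[OF x(1), of e] unfolding v_def by (simp add: mult_ac)
    moreover have "\<bar>e * x\<bar> = \<bar>x\<bar>" using ee(2) by (simp add: abs_mult)
    ultimately show ?thesis using x(2) by metis
  qed
  have gl: "g * l \<le> 2 * W" "g * l' \<le> 2 * W"
  proof -
    have "g * l * 1 \<le> g * l * l'" using g0 l l' by (intro mult_left_mono) auto
    then show "g * l \<le> 2 * W" using gll by simp
    have "g * l' * 1 \<le> g * l' * l" using g0 l l' by (intro mult_left_mono) auto
    then show "g * l' \<le> 2 * W" using gll by (simp add: mult_ac)
  qed
  have llpos: "l * l' > 0" using l l' by simp
  have gN: "g * int N \<le> 36 * W"
  proof -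
    have "g * int N \<le> g * (18 * (l * l'))" using ll g0 by (intro mult_left_mono) auto
    then show ?thesis using gll by (simp add: mult_ac)
  qed
  \<comment> \<open>The separate bounds multiply to \<open>W * N\<close>; by \<open>ll\<close>,
    dividing by \<open>l * l'\<close> replaces \<open>N\<close> by 18.\<close>
  have bound: "\<bar>x * y\<bar> \<le> 18 * W" if xy: "\<bar>x\<bar> * l' \<le> 1801 * int N" "\<bar>y\<bar> * l \<le> 1801 * int N" for x y
  proof -
    have "(\<bar>x\<bar> * l') * (\<bar>y\<bar> * l) \<le> (1801 * int N) * (1801 * int N)"
      by (rule mult_mono[OF xy]) (use l N1 in auto)
    also have "\<dots> = W * int N" unfolding W_def by simp
    also have "\<dots> \<le> W * (18 * (l * l'))" using ll WN N1 by (intro mult_left_mono) auto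
    finally have "\<bar>x * y\<bar> * (l * l') \<le> (18 * W) * (l * l')" by (simp add: abs_mult mult_ac)
    then show ?thesis using llpos by (rule mult_right_le_imp_le)
  qed
  define A1 where "A1 = {x. \<bar>x\<bar> * l' \<le> 1801 * int N \<and> (\<exists>a\<in>A. [v * a = x] (mod int p))}"
  define B1 where "B1 = {y. \<bar>y\<bar> * l \<le> 1801 * int N \<and> (\<exists>b\<in>B. [u * b = y] (mod int p))}"
  have exA1: "\<exists>x\<in>A1. [v * a = x] (mod int p)" if "a \<in> A" for a
    using va[OF that] that unfolding A1_def by blast
  have exB1: "\<exists>y\<in>B1. [u * b = y] (mod int p)" if "b \<in> B" for b
    using ub[OF that] that unfolding B1_def by blast
  have le1: "\<bar>x\<bar> \<le> 1801 * int N" if "\<bar>x\<bar> * m \<le> 1801 * int N" "m > 0" for x m :: int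
  proof -
    have "\<bar>x\<bar> * 1 \<le> \<bar>x\<bar> * m" using that(2) by (intro mult_left_mono) auto
    then show ?thesis using that(1) by linarith
  qed
  have A1b: "\<bar>x\<bar> \<le> W" if "x \<in> A1" for x
    using le1[of x l'] that l'(1) WN unfolding A1_def by auto
  have B1b: "\<bar>x\<bar> \<le> W" if "x \<in> B1" for x
    using le1[of x l] that l(1) WN unfolding B1_def by auto
  have finA1: "finite A1" by (rule finite_subset[of _ "{-W..W}"]) (use A1b in \<open>auto simp: abs_le_iff minus_le_iff\<close>)
  have finB1: "finite B1" by (rule finite_subset[of _ "{-W..W}"]) (use B1b in \<open>auto simp: abs_le_iff minus_le_iff\<close>)
  have card2: "card T \<ge> 2"
    if S: "card S \<ge> 2" "S \<subseteq> {0<..<int p}" and T: "finite T" and w: "\<not> int p dvd w"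
      and ex: "\<And>s. s \<in> S \<Longrightarrow> \<exists>x\<in>T. [w * s = x] (mod int p)" for S T w
  proof -
    have "\<not> card S \<le> Suc 0" using S(1) by simp
    moreover have "finite S" using S(2) finite_subset by blast
    ultimately obtain s s' where s: "s \<in> S" "s' \<in> S" "s \<noteq> s'" using card_le_Suc0_iff_eq by blast
    obtain x where x: "x \<in> T" "[w * s = x] (mod int p)" using ex[OF s(1)] by blast
    obtain x' where x': "x' \<in> T" "[w * s' = x'] (mod int p)" using ex[OF s(2)] by blast
    have "x \<noteq> x'"
    proof
      assume "x = x'"
      then have "[s * w = s' * w] (mod int p)" using x(2) x'(2) by (metis cong_sym cong_trans mult.commute)
      then have "[s = s'] (mod int p)" using cong_mult_cancel_prime[OF p w] by blast
      then have "s = s'" using s(1,2) S(2) by (intro cong_less_imp_eq_int[of s "int p" s']) auto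
      then show False using s(3) by simp
    qed
    then have "card {x, x'} = 2" by simp
    moreover have "card {x, x'} \<le> card T" using x(1) x'(1) T by (intro card_mono) auto
    ultimately show ?thesis by simp
  qed
  have cA1: "card A1 \<ge> 2"
    using card2[OF A(2,1) finA1 v exA1] .
  have cB1: "card B1 \<ge> 2"
    using card2[OF B(2,1) finB1 u exB1] .
  \<comment> \<open>\<open>x - x'\<close> is congruent to \<open>v * u * i\<close>, hence to
    \<open>g * i\<close>, and both sides are small enough to be equal.\<close>
  have dA1: "g dvd x - x'" if x: "x \<in> A1" "x' \<in> A1" for x x'
  proof -
    obtain a where a: "a \<in> A" "[v * a = x] (mod int p)" using x(1) unfolding A1_def by blast
    obtain a' where a': "a' \<in> A" "[v * a' = x'] (mod int p)" using x(2) unfolding A1_def by blast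
    obtain i where i: "\<bar>i\<bar> \<le> l" "[a - a' = u * i] (mod int p)"
      using ud[of "a - a'"] a(1) a'(1) unfolding diff_set_def by blast
    have 1: "[v * (a - a') = x - x'] (mod int p)" using cong_diff[OF a(2) a'(2)] by (simp add: right_diff_distrib)
    have 2: "[v * (a - a') = v * (u * i)] (mod int p)" using cong_scalar_left[OF i(2)] .
    have 3: "[v * (u * i) = g * i] (mod int p)" using cong_scalar_right[OF guv, of i] by (simp add: mult_ac)
    have "[x - x' = g * i] (mod int p)" using 1 2 3 by (meson cong_sym cong_trans)
    moreover have "\<bar>x - x'\<bar> \<le> 2 * W" using A1b[OF x(1)] A1b[OF x(2)] by linarith
    moreover have "\<bar>g * i\<bar> \<le> 2 * W"
    proof -
      have "\<bar>g * i\<bar> \<le> g * l" unfolding abs_mult using g0 i(1) by simp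
      then show ?thesis using gl by linarith
    qed
    ultimately have "x - x' = g * i" using pW WN N1 by (intro cong_small_imp_eq[of _ _ "int p" "2 * W" "2 * W"]) auto
    then show ?thesis by simp
  qed
  have dB1: "g dvd x - x'" if x: "x \<in> B1" "x' \<in> B1" for x x'
  proof -
    obtain a where a: "a \<in> B" "[u * a = x] (mod int p)" using x(1) unfolding B1_def by blast
    obtain a' where a': "a' \<in> B" "[u * a' = x'] (mod int p)" using x(2) unfolding B1_def by blast
    obtain i where i: "\<bar>i\<bar> \<le> l'" "[a - a' = v * i] (mod int p)"
      using vd[of "a - a'"] a(1) a'(1) unfolding diff_set_def by blast
    have 1: "[u * (a - a') = x - x'] (mod int p)" using cong_diff[OF a(2) a'(2)] by (simp add: right_diff_distrib)
    have 2: "[u * (a - a') = u * (v * i)] (mod int p)" using cong_scalar_left[OF i(2)] .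
    have 3: "[u * (v * i) = g * i] (mod int p)" using cong_scalar_right[OF guv, of i] by (simp add: mult_ac)
    have "[x - x' = g * i] (mod int p)" using 1 2 3 by (meson cong_sym cong_trans)
    moreover have "\<bar>x - x'\<bar> \<le> 2 * W" using B1b[OF x(1)] B1b[OF x(2)] by linarith
    moreover have "\<bar>g * i\<bar> \<le> 2 * W"
    proof -
      have "\<bar>g * i\<bar> \<le> g * l'" unfolding abs_mult using g0 i(1) by simp
      then show ?thesis using gl by linarith
    qed
    ultimately have "x - x' = g * i" using pW WN N1 by (intro cong_small_imp_eq[of _ _ "int p" "2 * W" "2 * W"]) auto
    then show ?thesis by simp
  qed
  have prod: "[x * y = g * (n + int i)] (mod int p)"
    if "[v * a = x] (mod int p)" "[u * b = y] (mod int p)" "[a * b = n + int i] (mod int p)" for a b x y i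
  proof -
    have "[x * y = (v * a) * (u * b)] (mod int p)" using cong_mult[OF that(1,2)] by (rule cong_sym)
    also have "(v * a) * (u * b) = (u * v) * (a * b)" by (simp add: mult_ac)
    also have "[\<dots> = g * (n + int i)] (mod int p)" using cong_mult[OF guv that(3)] .
    finally show ?thesis .
  qed
  have gi: "\<bar>g * int i\<bar> \<le> 36 * W" if "i \<le> N" for i
  proof -
    have "g * int i \<le> g * int N" using that g0 by simp
    moreover have "g * int i \<ge> 0" using g0 by simp
    ultimately show ?thesis using gN by linarith
  qed
  \<comment> \<open>\<open>n\<close> itself may be large. A small representative of
    \<open>g * n\<close> comes from subtracting \<open>g * i\<close> from one small product
    \<open>x * y\<close>.\<close>
  obtain n1 where n1: "[n1 = g * n] (mod int p)" "\<bar>n1\<bar> \<le> 54 * W"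
  proof -
    obtain a b where ab: "a \<in> A" "b \<in> B" using A(2) B(2) by fastforce
    obtain i where i: "1 \<le> i" "i \<le> N" "[a * b = n + int i] (mod int p)" using idx[OF ab] by blast
    obtain x where x: "[v * a = x] (mod int p)" "\<bar>x\<bar> * l' \<le> 1801 * int N" using va[OF ab(1)] by blast
    obtain y where y: "[u * b = y] (mod int p)" "\<bar>y\<bar> * l \<le> 1801 * int N" using ub[OF ab(2)] by blast
    have "[x * y - g * int i = g * (n + int i) - g * int i] (mod int p)"
      using cong_diff[OF prod[OF x(1) y(1) i(3)] cong_refl] .
    then have "[x * y - g * int i = g * n] (mod int p)" by (simp add: algebra_simps)
    moreover have "\<bar>x * y - g * int i\<bar> \<le> 54 * W" using bound[OF x(2) y(2)] gi[OF i(2)] by linarith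
    ultimately show ?thesis using that by blast
  qed
  have n1i: "[n1 + g * int i = g * (n + int i)] (mod int p)" for i
    using cong_add[OF n1(1) cong_refl, of "g * int i"] by (simp add: algebra_simps)
  have n1b: "\<bar>n1 + g * int i\<bar> \<le> 90 * W" if "i \<le> N" for i using n1(2) gi[OF that] by linarith
  have eqi: "x * y = n1 + g * int i"
    if "\<bar>x\<bar> * l' \<le> 1801 * int N" "\<bar>y\<bar> * l \<le> 1801 * int N" "[x * y = g * (n + int i)] (mod int p)" "i \<le> N" for x y i
    using bound[OF that(1,2)] n1b[OF that(4)] pW cong_trans[OF that(3) cong_sym[OF n1i]] WN N1
    by (intro cong_small_imp_eq[of _ _ "int p" "18 * W" "90 * W"]) auto
  have "{x * y |x y. x \<in> A1 \<and> y \<in> B1} = {n1 + g * int i |i. 1 \<le> i \<and> i \<le> N} - {0}"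
  proof (intro Set.set_eqI iffI)
    fix z assume "z \<in> {x * y |x y. x \<in> A1 \<and> y \<in> B1}"
    then obtain x y where z: "z = x * y" "x \<in> A1" "y \<in> B1" by blast
    obtain a where a: "a \<in> A" "[v * a = x] (mod int p)" using z(2) unfolding A1_def by blast
    obtain b where b: "b \<in> B" "[u * b = y] (mod int p)" using z(3) unfolding B1_def by blast
    obtain i where i: "1 \<le> i" "i \<le> N" "[a * b = n + int i] (mod int p)" using idx[OF a(1) b(1)] by blast
    have "z = n1 + g * int i" unfolding z(1)
      using eqi[OF _ _ prod[OF a(2) b(2) i(3)] i(2)] z(2,3) unfolding A1_def B1_def by blast
    moreover have "z \<noteq> 0"
    proof
      assume "z = 0"
      then have "[(v * a) * (u * b) = 0] (mod int p)" using cong_mult[OF a(2) b(2)] z(1) by metis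
      then have "int p dvd (v * a) * (u * b)" by (simp add: cong_0_iff)
      then show False using u v ndA[OF a(1)] ndB[OF b(1)] pint by (simp add: prime_dvd_mult_iff)
    qed
    ultimately show "z \<in> {n1 + g * int i |i. 1 \<le> i \<and> i \<le> N} - {0}" using i by blast
  next
    fix z assume "z \<in> {n1 + g * int i |i. 1 \<le> i \<and> i \<le> N} - {0}"
    then obtain i where i: "z = n1 + g * int i" "1 \<le> i" "i \<le> N" "z \<noteq> 0" by blast
    have "(n + int i) mod int p \<noteq> 0"
    proof
      assume "(n + int i) mod int p = 0"
      then have "int p dvd g * (n + int i)" by (simp add: mod_0_imp_dvd)
      then have "int p dvd z" using n1i[of i] i(1) by (metis cong_dvd_iff cong_sym)
      then have "int p \<le> \<bar>z\<bar>" using dvd_imp_le_int[of z "int p"] i(4) by simp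
      then show False using n1b[OF i(3)] i(1) pW WN N1 by linarith
    qed
    then have "(n + int i) mod int p \<in> {a * b mod int p |a b. a \<in> A \<and> b \<in> B}"
      unfolding AB using i(2,3) by blast
    then obtain a b where ab: "a \<in> A" "b \<in> B" "[a * b = n + int i] (mod int p)" unfolding cong_def by force
    obtain x where x: "[v * a = x] (mod int p)" "\<bar>x\<bar> * l' \<le> 1801 * int N" using va[OF ab(1)] by blast
    obtain y where y: "[u * b = y] (mod int p)" "\<bar>y\<bar> * l \<le> 1801 * int N" using ub[OF ab(2)] by blast
    have "x * y = z" using eqi[OF x(2) y(2) prod[OF x(1) y(1) ab(3)] i(3)] i(1) by simp
    moreover have "x \<in> A1" "y \<in> B1" unfolding A1_def B1_def using x y ab by blast+
    ultimately show "z \<in> {x * y |x y. x \<in> A1 \<and> y \<in> B1}" by blast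
  qed
  then have alternatives: "(\<exists>r. A1 = {- r, r}) \<or> (\<exists>r. B1 = {- r, r}) \<or> (N = 3 \<and> \<bar>3 * (n1 + 2 * g)\<bar> = g)"
    using integer_ap_product[OF g0 dA1 dB1 cA1 cB1] by blast
  \<comment> \<open>Dividing by \<open>w\<close> modulo \<open>p\<close> puts \<open>S\<close> into
    a pair of opposite residues, and its cardinality makes it the whole pair.\<close>
  have pull_back: "\<exists>r. S = {(- r) mod int p, r mod int p}"
    if S: "card S \<ge> 2" "S \<subseteq> {0<..<int p}" and w: "\<not> int p dvd w"
      and ex: "\<And>s. s \<in> S \<Longrightarrow> \<exists>x\<in>{- r, r}. [w * s = x] (mod int p)" for S w r
  proof -
    obtain c where c: "[w * c = 1] (mod int p)" using prime_inverse_mod[OF p w] .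
    have "S \<subseteq> {(- (r * c)) mod int p, (r * c) mod int p}"
    proof
      fix s assume s: "s \<in> S"
      then obtain x where x: "x = - r \<or> x = r" "[w * s = x] (mod int p)" using ex by blast
      have "[s * (w * c) = s * 1] (mod int p)" using cong_scalar_left[OF c] .
      moreover have "[s * (w * c) = x * c] (mod int p)" using cong_scalar_right[OF x(2), of c] by (simp add: mult_ac)
      ultimately have "[s = x * c] (mod int p)" by (metis cong_sym cong_trans mult.right_neutral)
      moreover have "s mod int p = s" using s S(2) by auto
      ultimately have "s = (x * c) mod int p" by (simp add: cong_def)
      then show "s \<in> {(- (r * c)) mod int p, (r * c) mod int p}" using x(1) by auto
    qed
    then show ?thesis using eq_pair_if_card_ge_2[OF S(1)] by blast
  qed
  have caseA: "\<exists>r. A = {(- r) mod int p, r mod int p}" if "A1 = {- r, r}" for r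
    using pull_back[OF A(2,1) v exA1[unfolded that]] .
  have caseB: "\<exists>r. B = {(- r) mod int p, r mod int p}" if "B1 = {- r, r}" for r
    using pull_back[OF B(2,1) u exB1[unfolded that]] .
  have exceptional: "[3 * (n + 2) = 1] (mod int p) \<or> [3 * (n + 2) = - 1] (mod int p)" if "\<bar>3 * (n1 + 2 * g)\<bar> = g"
  proof -
    have ndg: "\<not> int p dvd g"
    proof
      assume "int p dvd g"
      then have "int p dvd u * v" using guv by (metis cong_dvd_iff)
      then show False using u v pint by (simp add: prime_dvd_mult_iff)
    qed
    have *: "[3 * (n + 2) * g = 3 * (n1 + 2 * g)] (mod int p)"
      using cong_scalar_left[OF cong_sym[OF n1i[of 2]], of 3] by (simp add: mult_ac)
    have "3 * (n1 + 2 * g) = 1 * g \<or> 3 * (n1 + 2 * g) = (- 1) * g" using that g0 by linarith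
    then show ?thesis using * cong_mult_cancel_prime[OF p ndg] by metis
  qed
  show ?thesis using alternatives caseA caseB exceptional by blast
qed

section \<open>Intervals in the prime field\<close>

lemma interval_mod_subset: "p > 0 \<Longrightarrow> interval_mod p n N \<subseteq> {0..<int p}"
  unfolding interval_mod_def by auto

text \<open>The minimum covers parameters \<open>N\<close> beyond \<open>p\<close>, where the
  interval wraps around. A cardinality below \<open>p\<close> thus still bounds
  \<open>N\<close>.\<close>

lemma le_card_interval_mod:
  assumes "p > 0"
  shows "min N p \<le> card (interval_mod p n N)"
proof -
  have "inj_on (\<lambda>i. (n + int i) mod int p) {1..min N p}"
  proof (rule inj_onI)
    fix i j assume ij: "i \<in> {1..min N p}" "j \<in> {1..min N p}" "(n + int i) mod int p = (n + int j) mod int p"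
    then have "[n + int i = n + int j] (mod int p)" by (simp add: cong_def)
    then have "[int i = int j] (mod int p)" by (simp only: cong_add_lcancel)
    then have "[int i - 1 = int j - 1] (mod int p)" by (rule cong_diff) simp
    then have "int i - 1 = int j - 1" using ij by (intro cong_less_imp_eq_int) auto
    then show "i = j" by simp
  qed
  then have "card ((\<lambda>i. (n + int i) mod int p) ` {1..min N p}) = min N p" by (simp add: card_image)
  moreover have "(\<lambda>i. (n + int i) mod int p) ` {1..min N p} \<subseteq> interval_mod p n N"
    unfolding interval_mod_def by auto
  moreover have "finite (interval_mod p n N)" using interval_mod_subset[OF assms] finite_subset by blast
  ultimately show ?thesis by (metis card_mono)
qed

lemma decomposition_dichotomy:
  fixes p N :: nat and n :: int
  assumes p: "prime p" and N: "N \<ge> 1" and card: "10 ^ 10 * card (interval_mod p n N) < p"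
    and dec: "nontrivial_mult_decomp_by p (interval_mod p n N) A B"
  shows "(\<exists>r. A = {(- r) mod int p, r mod int p}) \<or> (\<exists>r. B = {(- r) mod int p, r mod int p}) \<or>
    (N = 3 \<and> ([3 * (n + 2) = 1] (mod int p) \<or> [3 * (n + 2) = - 1] (mod int p)))"
proof -
  interpret residues_prime p "Fp p" by unfold_locales (rule p)
  have p0: "p > 0" using p by (simp add: prime_gt_0_nat)
  have "min N p \<le> card (interval_mod p n N)" using le_card_interval_mod[OF p0] .
  then have Np: "10 ^ 10 * N \<le> p" using card by (auto simp: min_def split: if_splits)
  have sub: "A \<subseteq> {0..int p - 1}" "B \<subseteq> {0..int p - 1}" and c: "card A \<ge> 2" "card B \<ge> 2"
    and eq: "interval_mod p n N - {0} = A <#>\<^bsub>Fp p\<^esub> B"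
    using dec unfolding nontrivial_mult_decomp_by_def res_carrier_eq res_zero_eq by auto
  have prod: "A <#>\<^bsub>Fp p\<^esub> B = {a * b mod int p |a b. a \<in> A \<and> b \<in> B}"
    unfolding set_mult_def res_mult_eq by auto
  obtain a b where ab: "a \<in> A" "b \<in> B" using c by fastforce
  have nz: "x * y mod int p \<noteq> 0" if "x \<in> A" "y \<in> B" for x y
  proof -
    have "x * y mod int p \<in> A <#>\<^bsub>Fp p\<^esub> B" unfolding prod using that by blast
    then show ?thesis unfolding eq[symmetric] by simp
  qed
  \<comment> \<open>A factor containing 0 would make 0 a product, but 0 was removed from the
    interval.\<close>
  have "0 \<notin> A" "0 \<notin> B" using nz[of 0 b] nz[of a 0] ab by auto
  then have pos: "x \<in> {0<..<int p}" if "x \<in> A \<or> x \<in> B" for x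
    using that sub by (cases "x = 0") auto
  then have "A \<subseteq> {0<..<int p}" "B \<subseteq> {0<..<int p}" by blast+
  then show ?thesis
    by (rule mod_interval_factorization[OF p _ c(1) _ c(2) _ N Np])
      (use eq in \<open>simp add: prod interval_mod_def\<close>)
qed

lemma neg_set_eq: "prime p \<Longrightarrow> neg_set p S = (\<lambda>s. (- s) mod int p) ` S"
proof -
  assume p: "prime p"
  interpret residues_prime p "Fp p" by unfold_locales (rule p)
  show ?thesis unfolding neg_set_def res_neg_eq by auto
qed

text \<open>Negation permutes the factor consisting of \<open>r\<close> and \<open>- r\<close>, so
  the product set is closed under negation.\<close>

lemma interval_symmetric:
  assumes p: "prime p" and I: "I \<subseteq> {0..<int p}"
    and dec: "nontrivial_mult_decomp_by p I A B"
    and AB: "A = {(- r) mod int p, r mod int p} \<or> B = {(- r) mod int p, r mod int p}"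
  shows "I = neg_set p I"
proof -
  interpret residues_prime p "Fp p" by unfold_locales (rule p)
  have p0: "p > 0" using p by (simp add: prime_gt_0_nat)
  have eq: "I - {0} = {a * b mod int p |a b. a \<in> A \<and> b \<in> B}"
    using dec unfolding nontrivial_mult_decomp_by_def res_zero_eq set_mult_def res_mult_eq by auto
  have S: "(- s) mod int p \<in> {(- r) mod int p, r mod int p}" if "s \<in> {(- r) mod int p, r mod int p}" for s
    using that by (auto simp: mod_minus_eq)
  have neg: "(- x) mod int p \<in> I" if x: "x \<in> I" for x
  proof (cases "x = 0")
    case True
    then show ?thesis using x by simp
  next
    case False
    then obtain a b where ab: "a \<in> A" "b \<in> B" "x = a * b mod int p" using x eq by blast
    have e: "(- x) mod int p = ((- a) mod int p) * b mod int p" "(- x) mod int p = a * ((- b) mod int p) mod int p"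
      unfolding ab(3) by (simp_all add: mod_minus_eq mod_mult_left_eq mod_mult_right_eq)
    have "(- x) mod int p \<in> {a * b mod int p |a b. a \<in> A \<and> b \<in> B}"
      using AB
    proof
      assume "A = {(- r) mod int p, r mod int p}"
      then have "(- a) mod int p \<in> A" using S ab(1) by simp
      then show ?thesis using e(1) ab(2) by blast
    next
      assume "B = {(- r) mod int p, r mod int p}"
      then have "(- b) mod int p \<in> B" using S ab(2) by simp
      then show ?thesis using e(2) ab(1) by blast
    qed
    then show ?thesis using eq by blast
  qed
  have "x \<in> (\<lambda>s. (- s) mod int p) ` I" if x: "x \<in> I" for x
  proof (rule image_eqI)
    show "(- x) mod int p \<in> I" using neg[OF x] .
    show "x = (- ((- x) mod int p)) mod int p" using x I by (auto simp: mod_minus_eq)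
  qed
  then show ?thesis unfolding neg_set_eq[OF p] using neg by blast
qed

section \<open>The exceptional three-term interval\<close>

lemma interval_mod_3:
  "interval_mod p n 3 = {(n + 2 - 1) mod int p, (n + 2) mod int p, (n + 2 + 1) mod int p}"
proof -
  have "{i. 1 \<le> i \<and> i \<le> (3::nat)} = {1, 2, 3}" by auto
  then have "interval_mod p n 3 = (\<lambda>i. (n + int i) mod int p) ` {1, 2, 3}"
    unfolding interval_mod_def by blast
  then show ?thesis by (simp add: algebra_simps)
qed

lemma exceptional_set_eq:
  assumes p: "prime p" "p > 3"
  obtains t where "[3 * t = 1] (mod int p)"
    "exceptional_set p = {(t - 1) mod int p, t mod int p, (t + 1) mod int p}"
proof -
  interpret residues_prime p "Fp p" by unfold_locales (rule p)
  define t where "t = inv_mod p 3"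
  have three: "3 \<in> Units (Fp p)" unfolding res_prime_units_eq using p(2) by auto
  have t: "t = inv\<^bsub>Fp p\<^esub> 3" unfolding t_def inv_mod_def using p(2) by simp
  have tc: "t \<in> carrier (Fp p)" unfolding t using three by simp
  then have tm: "t mod int p = t" unfolding res_carrier_eq by auto
  have "3 \<otimes>\<^bsub>Fp p\<^esub> t = \<one>\<^bsub>Fp p\<^esub>" unfolding t using three by simp
  then have 1: "[3 * t = 1] (mod int p)" unfolding res_mult_eq res_one_eq cong_def using p(2) by simp
  have "exceptional_set p = {(t - 1) mod int p, t mod int p, (t + 1) mod int p}"
    unfolding exceptional_set_def t_def[symmetric] a_minus_def res_neg_eq res_add_eq res_one_eq tm
    by (simp add: mod_add_right_eq)
  then show ?thesis using that 1 by blast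
qed

text \<open>The congruence identifies the middle term \<open>n + 2\<close> with the inverse of 3 up
  to sign.\<close>

lemma exceptional_interval:
  assumes p: "prime p" "p > 3"
    and n: "[3 * (n + 2) = 1] (mod int p) \<or> [3 * (n + 2) = - 1] (mod int p)"
  shows "interval_mod p n 3 = exceptional_set p \<or> interval_mod p n 3 = neg_set p (exceptional_set p)"
proof -
  obtain t where t: "[3 * t = 1] (mod int p)"
    "exceptional_set p = {(t - 1) mod int p, t mod int p, (t + 1) mod int p}"
    using exceptional_set_eq[OF p] .
  have n3: "\<not> int p dvd 3" using p(2) zdvd_not_zless[of 3 "int p"] by auto
  from n show ?thesis
  proof
    assume "[3 * (n + 2) = 1] (mod int p)"
    then have "[(n + 2) * 3 = t * 3] (mod int p)" using t(1) by (metis cong_sym cong_trans mult.commute)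
    then have e: "[n + 2 = t] (mod int p)" using cong_mult_cancel_prime[OF p(1) n3] by blast
    then have "[n + 2 - 1 = t - 1] (mod int p)" "[n + 2 + 1 = t + 1] (mod int p)"
      by (intro cong_diff cong_add cong_refl; assumption)+
    then show ?thesis using e unfolding interval_mod_3 t(2) cong_def by simp
  next
    assume a: "[3 * (n + 2) = - 1] (mod int p)"
    have "[3 * (- t) = - 1] (mod int p)" using t(1) by (simp add: cong_minus_minus_iff)
    then have "[(n + 2) * 3 = (- t) * 3] (mod int p)" using a by (metis cong_sym cong_trans mult.commute)
    then have e: "[n + 2 = - t] (mod int p)" using cong_mult_cancel_prime[OF p(1) n3] by blast
    have "[n + 2 - 1 = - t - 1] (mod int p)" "[n + 2 + 1 = - t + 1] (mod int p)"
      using e by (intro cong_diff cong_add cong_refl; assumption)+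
    then have "(n + 2 - 1) mod int p = (- (t + 1)) mod int p" "(n + 2 + 1) mod int p = (- (t - 1)) mod int p"
      unfolding cong_def minus_add_distrib minus_diff_eq by (simp_all only: diff_conv_add_uminus add.commute)
    then show ?thesis using e unfolding interval_mod_3 t(2) neg_set_eq[OF p(1)] cong_def
      by (auto simp: mod_minus_eq)
  qed
qed

text \<open>This rules out the third alternative of \<open>decomposition_dichotomy\<close> when the
  interval is symmetric, so every decomposition then has a factor made of \<open>r\<close> and
  \<open>- r\<close>.\<close>

lemma exceptional_interval_not_symmetric:
  assumes p: "prime p" "p > 10"
    and n: "[3 * (n + 2) = 1] (mod int p) \<or> [3 * (n + 2) = - 1] (mod int p)"
  shows "interval_mod p n 3 \<noteq> neg_set p (interval_mod p n 3)"
proof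
  assume I: "interval_mod p n 3 = neg_set p (interval_mod p n 3)"
  define m where "m = n + 2"
  obtain e where e: "e = 1 \<or> e = - 1" "[3 * m = e] (mod int p)" using n unfolding m_def by blast
  have "(- ((m + 1) mod int p)) mod int p \<in> interval_mod p n 3"
    by (subst I) (simp add: neg_set_eq[OF p(1)] interval_mod_3 m_def)
  then have "(- (m + 1)) mod int p \<in> {(m - 1) mod int p, m mod int p, (m + 1) mod int p}"
    unfolding interval_mod_3 m_def[symmetric] by (simp add: mod_minus_eq)
  then obtain j where j: "j = - 1 \<or> j = 0 \<or> j = 1" "[- (m + 1) = m + j] (mod int p)"
    unfolding cong_def by fastforce
  have "int p dvd - (m + 1) - (m + j)" using j(2) by (simp add: cong_iff_dvd_diff)
  moreover have "int p dvd 3 * m - e" using e(2) by (simp add: cong_iff_dvd_diff)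
  \<comment> \<open>This combination eliminates \<open>m\<close>, leaving a nonzero integer of
    absolute value at most 8.\<close>
  ultimately have "int p dvd 3 * (- (m + 1) - (m + j)) + 2 * (3 * m - e)" by (meson dvd_add dvd_mult)
  then have d: "int p dvd - 3 - 3 * j - 2 * e" by (simp add: algebra_simps)
  have "- 3 - 3 * j - 2 * e \<noteq> 0" "\<bar>- 3 - 3 * j - 2 * e\<bar> \<le> 8" using e(1) j(1) by auto
  then show False using dvd_imp_le_int[of "- 3 - 3 * j - 2 * e" "int p"] d p(2) by auto
qed

section \<open>Decompositions of intervals of density below \<open>1 / 10 ^ 10\<close>\<close>

theorem theorem1:
  shows "\<exists>c::real. c > 0 \<and>
    (\<forall>p::nat. prime p \<longrightarrow>
      (\<forall>(n::int) (N::nat) I. N \<ge> 1 \<longrightarrow> I = interval_mod p n N \<longrightarrow>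
         real (card I) < c * real p \<longrightarrow>
         has_nontrivial_mult_decomp p I \<longrightarrow>
         (I = exceptional_set p \<or> I = neg_set p (exceptional_set p) \<or> I = neg_set p I) \<and>
         (I = neg_set p I \<longrightarrow>
           (\<forall>A B. nontrivial_mult_decomp_by p I A B \<longrightarrow>
             (\<exists>r\<in>carrier (Fp p). A = {\<ominus>\<^bsub>Fp p\<^esub> r, r} \<or> B = {\<ominus>\<^bsub>Fp p\<^esub> r, r})))))"
proof (intro exI[of _ "1 / 10 ^ 10"] conjI allI impI)
  fix p :: nat and n :: int and N :: nat and I
  assume p: "prime p" and N: "1 \<le> N" and I: "I = interval_mod p n N"
    and c: "real (card I) < 1 / 10 ^ 10 * real p"
  interpret residues_prime p "Fp p" by unfold_locales (rule p)
  have p0: "p > 0" using p by (simp add: prime_gt_0_nat)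
  have "real (10 ^ 10 * card I) < real p" using c by simp
  then have card: "10 ^ 10 * card (interval_mod p n N) < p" unfolding I of_nat_less_iff .
  \<comment> \<open>A nonempty interval of so small a density forces a large \<open>p\<close>; in
    particular 3 is invertible.\<close>
  have "card I \<ge> 1" using le_card_interval_mod[OF p0, of N n] N p0 unfolding I by simp
  then have p10: "p > 10" using card unfolding I by simp
  have Isub: "I \<subseteq> {0..<int p}" unfolding I using interval_mod_subset[OF p0] .
  have neg: "\<ominus>\<^bsub>Fp p\<^esub> (r mod int p) = (- r) mod int p" for r unfolding res_neg_eq by (simp add: mod_minus_eq)
  {
    assume "has_nontrivial_mult_decomp p I"
    then obtain A B where AB: "nontrivial_mult_decomp_by p I A B" unfolding has_nontrivial_mult_decomp_def by blast
    show "I = exceptional_set p \<or> I = neg_set p (exceptional_set p) \<or> I = neg_set p I"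
      using decomposition_dichotomy[OF p N card AB[unfolded I]] interval_symmetric[OF p Isub AB]
        exceptional_interval[OF p, of n] p10 I by fastforce
  next
    fix A B
    assume sym: "I = neg_set p I" and AB: "nontrivial_mult_decomp_by p I A B"
    then have "(\<exists>r. A = {(- r) mod int p, r mod int p}) \<or> (\<exists>r. B = {(- r) mod int p, r mod int p})"
      using decomposition_dichotomy[OF p N card AB[unfolded I]] exceptional_interval_not_symmetric[OF p p10, of n] I
      by blast
    then obtain r where "A = {(- r) mod int p, r mod int p} \<or> B = {(- r) mod int p, r mod int p}" by blast
    then show "\<exists>r\<in>carrier (Fp p). A = {\<ominus>\<^bsub>Fp p\<^esub> r, r} \<or> B = {\<ominus>\<^bsub>Fp p\<^esub> r, r}"
      by (intro bexI[of _ "r mod int p"]) (auto simp: neg)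
  }
qed simp

end
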